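(* Let $X=(M,J)$ be the $8$-dimensional nilmanifold $M=\Gamma\backslash G$ endowed with the invariant complex structure $J$ defined by a basis of $(1,0)$-forms $\{\omega^k\}_{k=1}^4$ satisfying $$d\omega^1=0,\qquad d\omega^2=-i\,\omega^{14}+i\,\omega^{1\bar4},\qquad d\omega^3=\omega^{12}+\omega^{1\bar2}-\omega^{2\bar1},\qquad d\omega^4=-\omega^{1\bar3}+\omega^{3\bar1}.$$ Then $X$ has non-flat neutral Calabi-Yau structures.
   Context: A nilmanifold is a compact quotient $M=\Gamma\backslash G$ of a connected, simply connected nilpotent Lie group $G$ by a lattice $\Gamma$ of maximal rank. An invariant complex structure $J$ on $M$ is one induced from a left-invariant complex structure on $G$; here the $\omega^k$ are complex-valued left-invariant $1$-forms on $G$ (descended to $M$) which form a basis of the invariant forms of bidegree $(1,0)$, and these structure equations determine $G$ and $J$. Notation: $\omega^{jk}=\omega^j\wedge\omega^k$, $\omega^{j\bar k}=\omega^j\wedge\overline{\omega^k}$. For a complex manifold $X=(M,J)$ of complex dimension $2m$, a neutral Kähler structure is a pseudo-Riemannian metric $g$ of signature $(2m,2m)$ with $g(JU,JV)=g(U,V)$ for all vector fields and $\nabla J=0$, where $\nabla$ is the Levi-Civita connection of $g$. It is neutral Calabi-Yau if there is a nowhere vanishing form $\Phi$ of bidegree $(2m,0)$ with $\nabla\Phi=0$. Non-flat means the curvature tensor of $g$ is not identically zero. *)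

theory Defs
  imports "HOL-Analysis.Analysis" "HOL-Algebra.Generated_Groups" "HOL-Algebra.Coset"
begin

section \<open>Smooth manifolds\<close>

abbreviation dderiv :: "('e::real_normed_vector \<Rightarrow> 'f::real_normed_vector) \<Rightarrow> 'e \<Rightarrow> 'e \<Rightarrow> 'f"
  where "dderiv f x u \<equiv> frechet_derivative f (at x) u"

text \<open>Both notions of differentiability below are meant for open \<open>S\<close>.\<close>

primrec times_differentiable_on ::
    "nat \<Rightarrow> 'e::euclidean_space set \<Rightarrow> ('e \<Rightarrow> 'f::real_normed_vector) \<Rightarrow> bool" where
  "times_differentiable_on 0 S f \<longleftrightarrow> continuous_on S f"
| "times_differentiable_on (Suc n) S f \<longleftrightarrow>
     (\<forall>x\<in>S. f differentiable (at x)) \<and>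
     (\<forall>u. times_differentiable_on n S (\<lambda>x. dderiv f x u))"

definition smooth_on :: "'e::euclidean_space set \<Rightarrow> ('e \<Rightarrow> 'f::real_normed_vector) \<Rightarrow> bool"
  where "smooth_on S f \<longleftrightarrow> (\<forall>n. times_differentiable_on n S f)"

text \<open>A chart is a domain together with a coordinate map; the values of the map outside the
  domain are irrelevant.\<close>

type_synonym ('a, 'e) chart = "'a set \<times> ('a \<Rightarrow> 'e)"

definition chart_image :: "('a, 'e) chart \<Rightarrow> 'e set"
  where "chart_image c = snd c ` fst c"

text \<open>The map \<open>f\<close> read in the charts \<open>c\<close> and \<open>d\<close>, and the set of
  coordinates on which this makes sense. For \<open>f = id\<close> this is the change of coordinates.\<close>

definition local_dom :: "('a \<Rightarrow> 'b) \<Rightarrow> ('a, 'e) chart \<Rightarrow> ('b, 'f) chart \<Rightarrow> 'e set"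
  where "local_dom f c d = snd c ` {p \<in> fst c. f p \<in> fst d}"

definition local_rep :: "('a \<Rightarrow> 'b) \<Rightarrow> ('a, 'e) chart \<Rightarrow> ('b, 'f) chart \<Rightarrow> 'e \<Rightarrow> 'f"
  where "local_rep f c d = snd d \<circ> f \<circ> inv_into (fst c) (snd c)"

abbreviation tangent_map ::
    "('a \<Rightarrow> 'b) \<Rightarrow> ('a, 'e::euclidean_space) chart \<Rightarrow> ('b, 'f::euclidean_space) chart
      \<Rightarrow> 'e \<Rightarrow> 'e \<Rightarrow> 'f"
  where "tangent_map f c d x u \<equiv> dderiv (local_rep f c d) x u"

definition smooth_manifold :: "'a topology \<Rightarrow> ('a, 'e::euclidean_space) chart set \<Rightarrow> bool"
  where "smooth_manifold X A \<longleftrightarrow>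
    Hausdorff_space X \<and> second_countable X \<and> (\<Union>c\<in>A. fst c) = topspace X \<and>
    (\<forall>c\<in>A. openin X (fst c) \<and> open (chart_image c) \<and>
       homeomorphic_map (subtopology X (fst c)) (top_of_set (chart_image c)) (snd c)) \<and>
    (\<forall>c\<in>A. \<forall>d\<in>A. smooth_on (local_dom id c d) (local_rep id c d))"

definition smooth_map ::
    "'a topology \<Rightarrow> ('a, 'e::euclidean_space) chart set \<Rightarrow>
     'b topology \<Rightarrow> ('b, 'f::euclidean_space) chart set \<Rightarrow> ('a \<Rightarrow> 'b) \<Rightarrow> bool"
  where "smooth_map X A Y B f \<longleftrightarrow> continuous_map X Y f \<and>
    (\<forall>c\<in>A. \<forall>d\<in>B. smooth_on (local_dom f c d) (local_rep f c d))"

definition product_atlas ::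
    "('a, 'e) chart set \<Rightarrow> ('b, 'f) chart set \<Rightarrow> ('a \<times> 'b, 'e \<times> 'f) chart set"
  where "product_atlas A B = {(fst c \<times> fst d, map_prod (snd c) (snd d)) | c d. c \<in> A \<and> d \<in> B}"


section \<open>Tensor fields\<close>

text \<open>
  A tensor field on a manifold with atlas \<open>A\<close> is given by its components in each chart
  \<open>c \<in> A\<close>: a function of the coordinates \<open>x \<in> chart_image c\<close>, and of
  tangent vectors written in the chart \<open>c\<close>. The components in different charts are
  related by the tensor transformation law, which is naturality under the map \<open>id\<close>.
  Values at charts outside \<open>A\<close> or coordinates outside \<open>chart_image c\<close> are
  irrelevant.
\<close>

type_synonym ('a, 'e) one_form = "('a, 'e) chart \<Rightarrow> 'e \<Rightarrow> 'e \<Rightarrow> complex"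
type_synonym ('a, 'e, 'i) multi_form = "('a, 'e) chart \<Rightarrow> 'e \<Rightarrow> ('i \<Rightarrow> 'e) \<Rightarrow> complex"
type_synonym ('a, 'e) bilinear_field = "('a, 'e) chart \<Rightarrow> 'e \<Rightarrow> 'e \<Rightarrow> 'e \<Rightarrow> real"
type_synonym ('a, 'e) endo_field = "('a, 'e) chart \<Rightarrow> 'e \<Rightarrow> 'e \<Rightarrow> 'e"
type_synonym ('a, 'e) conn = "('a, 'e) chart \<Rightarrow> 'e \<Rightarrow> 'e \<Rightarrow> 'e \<Rightarrow> 'e"

text \<open>\<open>\<alpha> = f\<^sup>* \<beta>\<close> for a smooth map \<open>f\<close>.\<close>

definition is_pullback ::
    "('a \<Rightarrow> 'b) \<Rightarrow> ('a, 'e::euclidean_space) chart set \<Rightarrow> ('b, 'f::euclidean_space) chart set \<Rightarrow>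
     ('a, 'e) one_form \<Rightarrow> ('b, 'f) one_form \<Rightarrow> bool"
  where "is_pullback f A B \<alpha> \<beta> \<longleftrightarrow>
    (\<forall>c\<in>A. \<forall>d\<in>B. \<forall>x\<in>local_dom f c d. \<forall>u.
       \<alpha> c x u = \<beta> d (local_rep f c d x) (tangent_map f c d x u))"

definition one_form :: "('a, 'e::euclidean_space) chart set \<Rightarrow> ('a, 'e) one_form \<Rightarrow> bool"
  where "one_form A \<alpha> \<longleftrightarrow>
    (\<forall>c\<in>A. (\<forall>x\<in>chart_image c. linear (\<alpha> c x)) \<and>
            (\<forall>u. smooth_on (chart_image c) (\<lambda>x. \<alpha> c x u))) \<and>
    is_pullback id A A \<alpha> \<alpha>"

text \<open>\<open>d f \<circ> J = J' \<circ> d f\<close>\<close>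

definition f_related ::
    "('a \<Rightarrow> 'b) \<Rightarrow> ('a, 'e::euclidean_space) chart set \<Rightarrow> ('b, 'f::euclidean_space) chart set \<Rightarrow>
     ('a, 'e) endo_field \<Rightarrow> ('b, 'f) endo_field \<Rightarrow> bool"
  where "f_related f A B J J' \<longleftrightarrow>
    (\<forall>c\<in>A. \<forall>d\<in>B. \<forall>x\<in>local_dom f c d. \<forall>u.
       tangent_map f c d x (J c x u) = J' d (local_rep f c d x) (tangent_map f c d x u))"

definition endo_field :: "('a, 'e::euclidean_space) chart set \<Rightarrow> ('a, 'e) endo_field \<Rightarrow> bool"
  where "endo_field A J \<longleftrightarrow>
    (\<forall>c\<in>A. (\<forall>x\<in>chart_image c. linear (J c x)) \<and>
            (\<forall>u. smooth_on (chart_image c) (\<lambda>x. J c x u))) \<and>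
    f_related id A A J J"

definition bilinear_field :: "('a, 'e::euclidean_space) chart set \<Rightarrow> ('a, 'e) bilinear_field \<Rightarrow> bool"
  where "bilinear_field A g \<longleftrightarrow>
    (\<forall>c\<in>A. (\<forall>x\<in>chart_image c. bilinear (g c x)) \<and>
            (\<forall>u v. smooth_on (chart_image c) (\<lambda>x. g c x u v))) \<and>
    (\<forall>c\<in>A. \<forall>d\<in>A. \<forall>x\<in>local_dom id c d. \<forall>u v.
       g c x u v = g d (local_rep id c d x) (tangent_map id c d x u) (tangent_map id c d x v))"

text \<open>The degree of the form is \<open>CARD('i)\<close>; its arguments are indexed by \<open>'i\<close>.\<close>

definition multi_form :: "('a, 'e::euclidean_space) chart set \<Rightarrow> ('a, 'e, 'i::finite) multi_form \<Rightarrow> bool"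
  where "multi_form A \<Phi> \<longleftrightarrow>
    (\<forall>c\<in>A. (\<forall>x\<in>chart_image c.
               (\<forall>v i. linear (\<lambda>u. \<Phi> c x (v(i := u)))) \<and>
               (\<forall>v i j. i \<noteq> j \<and> v i = v j \<longrightarrow> \<Phi> c x v = 0)) \<and>
            (\<forall>v. smooth_on (chart_image c) (\<lambda>x. \<Phi> c x v))) \<and>
    (\<forall>c\<in>A. \<forall>d\<in>A. \<forall>x\<in>local_dom id c d. \<forall>v.
       \<Phi> c x v = \<Phi> d (local_rep id c d x) (\<lambda>i. tangent_map id c d x (v i)))"

text \<open>Exterior calculus of \<open>1\<close>-forms, with the conventions
  \<open>(\<alpha> \<and> \<beta>)(u,v) = \<alpha>(u) \<beta>(v) - \<alpha>(v) \<beta>(u)\<close> and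
  \<open>d\<alpha>(U,V) = U(\<alpha>(V)) - V(\<alpha>(U)) - \<alpha>([U,V])\<close>, the latter evaluated on vector
  fields with constant components in the chart.\<close>

definition wedge ::
    "('a, 'e) one_form \<Rightarrow> ('a, 'e) one_form \<Rightarrow> ('a, 'e) chart \<Rightarrow> 'e \<Rightarrow> 'e \<Rightarrow> 'e \<Rightarrow> complex"
  where "wedge \<alpha> \<beta> c x u v = \<alpha> c x u * \<beta> c x v - \<alpha> c x v * \<beta> c x u"

definition ext_d ::
    "('a, 'e::euclidean_space) one_form \<Rightarrow> ('a, 'e) chart \<Rightarrow> 'e \<Rightarrow> 'e \<Rightarrow> 'e \<Rightarrow> complex"
  where "ext_d \<alpha> c x u v = dderiv (\<lambda>y. \<alpha> c y v) x u - dderiv (\<lambda>y. \<alpha> c y u) x v"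

definition conj_form :: "('a, 'e) one_form \<Rightarrow> ('a, 'e) one_form"
  where "conj_form \<alpha> c x u = cnj (\<alpha> c x u)"


section \<open>Complex structures\<close>

text \<open>A complex structure is an integrable almost complex structure. The last clause is the
  vanishing of the Nijenhuis tensor
  \<open>[JU,JV] - J[JU,V] - J[U,JV] - [U,V]\<close>, evaluated on vector fields \<open>U\<close>,
  \<open>V\<close> with constant components in the chart.\<close>

definition complex_structure :: "('a, 'e::euclidean_space) chart set \<Rightarrow> ('a, 'e) endo_field \<Rightarrow> bool"
  where "complex_structure A J \<longleftrightarrow> endo_field A J \<and>
    (\<forall>c\<in>A. \<forall>x\<in>chart_image c. \<forall>u. J c x (J c x u) = - u) \<and>
    (\<forall>c\<in>A. \<forall>x\<in>chart_image c. \<forall>u v.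
       dderiv (\<lambda>y. J c y v) x (J c x u) - dderiv (\<lambda>y. J c y u) x (J c x v)
       + J c x (dderiv (\<lambda>y. J c y u) x v) - J c x (dderiv (\<lambda>y. J c y v) x u) = 0)"

definition type_1_0 ::
    "('a, 'e) chart set \<Rightarrow> ('a, 'e) endo_field \<Rightarrow> ('a, 'e) one_form \<Rightarrow> bool"
  where "type_1_0 A J \<alpha> \<longleftrightarrow>
    (\<forall>c\<in>A. \<forall>x\<in>chart_image c. \<forall>u. \<alpha> c x (J c x u) = \<i> * \<alpha> c x u)"

text \<open>Bidegree \<open>(CARD('i), 0)\<close>: contraction of any slot with a vector \<open>u + \<i> J u\<close>
  of type \<open>(0,1)\<close> gives zero.\<close>

definition type_p_0 ::
    "('a, 'e) chart set \<Rightarrow> ('a, 'e) endo_field \<Rightarrow> ('a, 'e, 'i) multi_form \<Rightarrow> bool"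
  where "type_p_0 A J \<Phi> \<longleftrightarrow>
    (\<forall>c\<in>A. \<forall>x\<in>chart_image c. \<forall>v i. \<Phi> c x v + \<i> * \<Phi> c x (v(i := J c x (v i))) = 0)"


section \<open>Connections and neutral Calabi-Yau structures\<close>

text \<open>\<open>D c x u v\<close> is the value at \<open>x\<close> of \<open>\<nabla>\<^sub>U V\<close> for the vector fields
  \<open>U\<close>, \<open>V\<close> with constant components \<open>u\<close>, \<open>v\<close> in the chart
  \<open>c\<close>, i.e. \<open>D c\<close> collects the Christoffel symbols of the chart.\<close>

definition affine_connection :: "('a, 'e::euclidean_space) chart set \<Rightarrow> ('a, 'e) conn \<Rightarrow> bool"
  where "affine_connection A D \<longleftrightarrow>
    (\<forall>c\<in>A. (\<forall>x\<in>chart_image c. bilinear (D c x)) \<and>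
            (\<forall>u v. smooth_on (chart_image c) (\<lambda>x. D c x u v))) \<and>
    (\<forall>c\<in>A. \<forall>d\<in>A. \<forall>x\<in>local_dom id c d. \<forall>u v.
       tangent_map id c d x (D c x u v) =
         dderiv (\<lambda>y. tangent_map id c d y v) x u +
         D d (local_rep id c d x) (tangent_map id c d x u) (tangent_map id c d x v))"

definition levi_civita ::
    "('a, 'e::euclidean_space) chart set \<Rightarrow> ('a, 'e) bilinear_field \<Rightarrow> ('a, 'e) conn \<Rightarrow> bool"
  where "levi_civita A g D \<longleftrightarrow> affine_connection A D \<and>
    (\<forall>c\<in>A. \<forall>x\<in>chart_image c. \<forall>u v. D c x u v = D c x v u) \<and>
    (\<forall>c\<in>A. \<forall>x\<in>chart_image c. \<forall>u v w.
       dderiv (\<lambda>y. g c y u v) x w - g c x (D c x w u) v - g c x u (D c x w v) = 0)"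

definition parallel_endo ::
    "('a, 'e::euclidean_space) chart set \<Rightarrow> ('a, 'e) conn \<Rightarrow> ('a, 'e) endo_field \<Rightarrow> bool"
  where "parallel_endo A D J \<longleftrightarrow>
    (\<forall>c\<in>A. \<forall>x\<in>chart_image c. \<forall>v w.
       dderiv (\<lambda>y. J c y v) x w + D c x w (J c x v) - J c x (D c x w v) = 0)"

definition parallel_form ::
    "('a, 'e::euclidean_space) chart set \<Rightarrow> ('a, 'e) conn \<Rightarrow> ('a, 'e, 'i::finite) multi_form \<Rightarrow> bool"
  where "parallel_form A D \<Phi> \<longleftrightarrow>
    (\<forall>c\<in>A. \<forall>x\<in>chart_image c. \<forall>v w.
       dderiv (\<lambda>y. \<Phi> c y v) x w - (\<Sum>i\<in>UNIV. \<Phi> c x (v(i := D c x w (v i)))) = 0)"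

definition curvature ::
    "('a, 'e::euclidean_space) conn \<Rightarrow> ('a, 'e) chart \<Rightarrow> 'e \<Rightarrow> 'e \<Rightarrow> 'e \<Rightarrow> 'e \<Rightarrow> 'e"
  where "curvature D c x u v w =
    dderiv (\<lambda>y. D c y v w) x u - dderiv (\<lambda>y. D c y u w) x v
    + D c x u (D c x v w) - D c x v (D c x u w)"

definition flat :: "('a, 'e::euclidean_space) chart set \<Rightarrow> ('a, 'e) conn \<Rightarrow> bool"
  where "flat A D \<longleftrightarrow> (\<forall>c\<in>A. \<forall>x\<in>chart_image c. \<forall>u v w. curvature D c x u v w = 0)"

text \<open>For a symmetric bilinear form \<open>b\<close>; as \<open>p + q\<close> is the full dimension,
  \<open>b\<close> is nondegenerate.\<close>

definition has_signature :: "('e::euclidean_space \<Rightarrow> 'e \<Rightarrow> real) \<Rightarrow> nat \<Rightarrow> nat \<Rightarrow> bool"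
  where "has_signature b p q \<longleftrightarrow> p + q = DIM('e) \<and>
    (\<exists>P N. subspace P \<and> subspace N \<and> dim P = p \<and> dim N = q \<and>
       (\<forall>u\<in>P. u \<noteq> 0 \<longrightarrow> b u u > 0) \<and> (\<forall>u\<in>N. u \<noteq> 0 \<longrightarrow> b u u < 0))"

definition pseudo_riemannian ::
    "('a, 'e::euclidean_space) chart set \<Rightarrow> nat \<Rightarrow> nat \<Rightarrow> ('a, 'e) bilinear_field \<Rightarrow> bool"
  where "pseudo_riemannian A p q g \<longleftrightarrow> bilinear_field A g \<and>
    (\<forall>c\<in>A. \<forall>x\<in>chart_image c. (\<forall>u v. g c x u v = g c x v u) \<and> has_signature (g c x) p q)"

text \<open>The real dimension is \<open>4m\<close>; \<open>D\<close> is the Levi-Civita connection of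
  \<open>g\<close>, which is unique on the chart images.\<close>

definition neutral_kaehler ::
    "('a, 'e::euclidean_space) chart set \<Rightarrow> ('a, 'e) endo_field \<Rightarrow>
     ('a, 'e) bilinear_field \<Rightarrow> ('a, 'e) conn \<Rightarrow> bool"
  where "neutral_kaehler A J g D \<longleftrightarrow>
    (\<exists>m. DIM('e) = 4 * m \<and> pseudo_riemannian A (2 * m) (2 * m) g) \<and>
    (\<forall>c\<in>A. \<forall>x\<in>chart_image c. \<forall>u v. g c x (J c x u) (J c x v) = g c x u v) \<and>
    levi_civita A g D \<and> parallel_endo A D J"

definition neutral_calabi_yau ::
    "('a, 'e::euclidean_space) chart set \<Rightarrow> ('a, 'e) endo_field \<Rightarrow>
     ('a, 'e) bilinear_field \<Rightarrow> ('a, 'e) conn \<Rightarrow> ('a, 'e, 'i::finite) multi_form \<Rightarrow> bool"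
  where "neutral_calabi_yau A J g D \<Phi> \<longleftrightarrow>
    neutral_kaehler A J g D \<and>
    DIM('e) = 2 * CARD('i) \<and> multi_form A \<Phi> \<and> type_p_0 A J \<Phi> \<and>
    (\<forall>c\<in>A. \<forall>x\<in>chart_image c. \<exists>v. \<Phi> c x v \<noteq> 0) \<and>
    parallel_form A D \<Phi>"


section \<open>Nilmanifolds\<close>

definition lie_group ::
    "('g::topological_space) monoid \<Rightarrow> ('g, 'e::euclidean_space) chart set \<Rightarrow> bool"
  where "lie_group G A \<longleftrightarrow> group G \<and> carrier G = UNIV \<and>
    smooth_manifold euclidean A \<and>
    smooth_map (prod_topology euclidean euclidean) (product_atlas A A) euclidean A
      (\<lambda>(a, b). a \<otimes>\<^bsub>G\<^esub> b) \<and>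
    smooth_map euclidean A euclidean A (\<lambda>a. inv\<^bsub>G\<^esub> a)"

primrec lower_central :: "'g monoid \<Rightarrow> nat \<Rightarrow> 'g set" where
  "lower_central G 0 = carrier G"
| "lower_central G (Suc n) = generate G
     {x \<otimes>\<^bsub>G\<^esub> y \<otimes>\<^bsub>G\<^esub> inv\<^bsub>G\<^esub> x \<otimes>\<^bsub>G\<^esub> inv\<^bsub>G\<^esub> y | x y. x \<in> lower_central G n \<and> y \<in> carrier G}"

definition nilpotent_group :: "'g monoid \<Rightarrow> bool"
  where "nilpotent_group G \<longleftrightarrow> (\<exists>n. lower_central G n = {\<one>\<^bsub>G\<^esub>})"

definition quotient_topology :: "'a topology \<Rightarrow> ('a \<Rightarrow> 'b) \<Rightarrow> 'b topology"
  where "quotient_topology X f =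
    topology (\<lambda>S. S \<subseteq> f ` topspace X \<and> openin X {x \<in> topspace X. f x \<in> S})"

lemma openin_quotient_topology:
  "openin (quotient_topology X f) S \<longleftrightarrow>
     S \<subseteq> f ` topspace X \<and> openin X {x \<in> topspace X. f x \<in> S}"
proof -
  have "istopology (\<lambda>S. S \<subseteq> f ` topspace X \<and> openin X {x \<in> topspace X. f x \<in> S})"
    unfolding istopology_def
  proof (intro conjI allI impI; (elim conjE)?)
    fix S T
    assume "openin X {x \<in> topspace X. f x \<in> S}" "openin X {x \<in> topspace X. f x \<in> T}"
    then have "openin X ({x \<in> topspace X. f x \<in> S} \<inter> {x \<in> topspace X. f x \<in> T})"
      by (rule openin_Int)
    moreover have "{x \<in> topspace X. f x \<in> S} \<inter> {x \<in> topspace X. f x \<in> T}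
        = {x \<in> topspace X. f x \<in> S \<inter> T}" by blast
    ultimately show "openin X {x \<in> topspace X. f x \<in> S \<inter> T}" by simp
  next
    fix \<K>
    assume *: "\<forall>K\<in>\<K>. K \<subseteq> f ` topspace X \<and> openin X {x \<in> topspace X. f x \<in> K}"
    have "openin X (\<Union>K\<in>\<K>. {x \<in> topspace X. f x \<in> K})"
      using * by (intro openin_clauses(3)) auto
    moreover have "(\<Union>K\<in>\<K>. {x \<in> topspace X. f x \<in> K}) = {x \<in> topspace X. f x \<in> \<Union>\<K>}"
      by blast
    ultimately show "openin X {x \<in> topspace X. f x \<in> \<Union>\<K>}" by simp
  qed blast+
  then show ?thesis
    unfolding quotient_topology_def by simp
qed

lemma quotient_map_quotient_topology: "quotient_map X (quotient_topology X f) f"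
proof -
  have "openin (quotient_topology X f) (f ` topspace X)"
    unfolding openin_quotient_topology by (simp add: Collect_conj_eq Int_absorb2 subset_iff)
  then have "topspace (quotient_topology X f) = f ` topspace X"
    by (meson openin_quotient_topology openin_subset openin_topspace subset_antisym)
  then show ?thesis
    by (simp add: quotient_map_def openin_quotient_topology)
qed

text \<open>The points of \<open>\<Gamma> \ G\<close> are the right cosets \<open>\<Gamma> g\<close>, i.e.
  the elements of \<open>rcosets\<^bsub>G\<^esub> \<Gamma>\<close>.\<close>

abbreviation coset_proj :: "'g monoid \<Rightarrow> 'g set \<Rightarrow> 'g \<Rightarrow> 'g set"
  where "coset_proj G \<Gamma> g \<equiv> \<Gamma> #>\<^bsub>G\<^esub> g"

definition quotient_space :: "('g::topological_space) monoid \<Rightarrow> 'g set \<Rightarrow> 'g set topology"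
  where "quotient_space G \<Gamma> = quotient_topology euclidean (coset_proj G \<Gamma>)"

text \<open>The smooth structure for which the projection is a local diffeomorphism: its charts are
  the charts of \<open>G\<close>, restricted to open sets on which the projection is injective and
  transported along the projection.\<close>

definition quotient_atlas ::
    "('g::topological_space) monoid \<Rightarrow> 'g set \<Rightarrow> ('g, 'e) chart set \<Rightarrow> ('g set, 'e) chart set"
  where "quotient_atlas G \<Gamma> A =
    {(coset_proj G \<Gamma> ` W, snd c \<circ> inv_into W (coset_proj G \<Gamma>)) | W c.
       c \<in> A \<and> open W \<and> W \<subseteq> fst c \<and> inj_on (coset_proj G \<Gamma>) W}"

definition lattice_subgroup :: "('g::topological_space) monoid \<Rightarrow> 'g set \<Rightarrow> bool"
  where "lattice_subgroup G \<Gamma> \<longleftrightarrow>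
    subgroup \<Gamma> G \<and> discrete \<Gamma> \<and> compact_space (quotient_space G \<Gamma>)"

definition nilmanifold ::
    "('g::topological_space) monoid \<Rightarrow> ('g, 'e::euclidean_space) chart set \<Rightarrow> 'g set \<Rightarrow> bool"
  where "nilmanifold G A \<Gamma> \<longleftrightarrow>
    lie_group G A \<and> nilpotent_group G \<and>
    connected (UNIV :: 'g set) \<and> simply_connected (UNIV :: 'g set) \<and>
    lattice_subgroup G \<Gamma>"

definition left_invariant_complex_structure ::
    "'g monoid \<Rightarrow> ('g, 'e::euclidean_space) chart set \<Rightarrow> ('g, 'e) endo_field \<Rightarrow> bool"
  where "left_invariant_complex_structure G A J \<longleftrightarrow>
    complex_structure A J \<and> (\<forall>a\<in>carrier G. f_related (\<lambda>b. a \<otimes>\<^bsub>G\<^esub> b) A A J J)"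

definition left_invariant_form ::
    "'g monoid \<Rightarrow> ('g, 'e::euclidean_space) chart set \<Rightarrow> ('g, 'e) one_form \<Rightarrow> bool"
  where "left_invariant_form G A \<alpha> \<longleftrightarrow>
    one_form A \<alpha> \<and> (\<forall>a\<in>carrier G. is_pullback (\<lambda>b. a \<otimes>\<^bsub>G\<^esub> b) A A \<alpha> \<alpha>)"

definition basis_invariant_1_0_forms ::
    "'g monoid \<Rightarrow> ('g, 'e::euclidean_space) chart set \<Rightarrow> ('g, 'e) endo_field \<Rightarrow>
     ('k::finite \<Rightarrow> ('g, 'e) one_form) \<Rightarrow> bool"
  where "basis_invariant_1_0_forms G A J \<omega> \<longleftrightarrow>
    (\<forall>k. left_invariant_form G A (\<omega> k) \<and> type_1_0 A J (\<omega> k)) \<and>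
    (\<forall>\<alpha>. left_invariant_form G A \<alpha> \<and> type_1_0 A J \<alpha> \<longrightarrow>
       (\<exists>!a. \<forall>c\<in>A. \<forall>x\<in>chart_image c. \<forall>u. \<alpha> c x u = (\<Sum>k\<in>UNIV. a k * \<omega> k c x u)))"

text \<open>The complex structure \<open>J\<close> on \<open>\<Gamma> \ G\<close> induced by the left-invariant
  complex structure \<open>J0\<close> on \<open>G\<close>.\<close>

definition induced_complex_structure ::
    "('g::topological_space) monoid \<Rightarrow> ('g, 'e::euclidean_space) chart set \<Rightarrow> 'g set \<Rightarrow>
     ('g, 'e) endo_field \<Rightarrow> ('g set, 'e) endo_field \<Rightarrow> bool"
  where "induced_complex_structure G A \<Gamma> J0 J \<longleftrightarrow>
    left_invariant_complex_structure G A J0 \<and>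
    complex_structure (quotient_atlas G \<Gamma> A) J \<and>
    f_related (coset_proj G \<Gamma>) A (quotient_atlas G \<Gamma> A) J0 J"

text \<open>The index type \<open>4\<close> has exactly the elements
  \<open>1\<close>, \<open>2\<close>, \<open>3\<close>, \<open>4\<close> (where \<open>4 = 0\<close>).\<close>

definition structure_equations ::
    "('g, 'e::euclidean_space) chart set \<Rightarrow> (4 \<Rightarrow> ('g, 'e) one_form) \<Rightarrow> bool"
  where "structure_equations A \<omega> \<longleftrightarrow>
    (\<forall>c\<in>A. \<forall>x\<in>chart_image c. \<forall>u v.
       ext_d (\<omega> 1) c x u v = 0 \<and>
       ext_d (\<omega> 2) c x u v =
         - \<i> * wedge (\<omega> 1) (\<omega> 4) c x u v + \<i> * wedge (\<omega> 1) (conj_form (\<omega> 4)) c x u v \<and>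
       ext_d (\<omega> 3) c x u v =
         wedge (\<omega> 1) (\<omega> 2) c x u v + wedge (\<omega> 1) (conj_form (\<omega> 2)) c x u v
         - wedge (\<omega> 2) (conj_form (\<omega> 1)) c x u v \<and>
       ext_d (\<omega> 4) c x u v =
         - wedge (\<omega> 1) (conj_form (\<omega> 3)) c x u v + wedge (\<omega> 3) (conj_form (\<omega> 1)) c x u v)"

end

theory Submission
  imports Defs
begin

text \<open>The structure is invariant and can be written down in the coframe \<open>\<omega> = (\<omega>\<^sup>1, \<dots>, \<omega>\<^sup>4)\<close>, which
  identifies every tangent space with \<open>\<complex>\<^sup>4\<close> so that \<open>J\<close> becomes multiplication by \<open>\<i>\<close>. The real
  \<open>(1,1)\<close>-form
  \<open>F = \<i> \<omega>\<^sup>1 \<and> cnj \<omega>\<^sup>1 + \<omega>\<^sup>2 \<and> cnj \<omega>\<^sup>3 - \<omega>\<^sup>3 \<and> cnj \<omega>\<^sup>2 - \<i> \<omega>\<^sup>4 \<and> cnj \<omega>\<^sup>4\<close>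
  is closed by the structure equations, and the Hermitian form belonging to it has complex signature
  \<open>(2,2)\<close>. So its real part \<open>g\<close> is a neutral metric whose Levi-Civita connection preserves \<open>J\<close>.

  The connection form \<open>\<theta>\<close> of this metric has constant coefficients in the coframe
  (\<open>connection_matrix\<close>). It is characterised by \<open>d\<omega> = - \<theta> \<and> \<omega>\<close> and by being skew-Hermitian, and both
  are finite verifications (\<open>structure_equations_torsion_free\<close>, \<open>frame_metric_skew\<close>). Being a matrix
  of complex numbers it commutes with \<open>\<i>\<close>, hence \<open>\<nabla>J = 0\<close>. Its trace vanishes, hence the complex
  volume form \<open>\<omega>\<^sup>1 \<and> \<omega>\<^sup>2 \<and> \<omega>\<^sup>3 \<and> \<omega>\<^sup>4\<close> is parallel (\<open>parallel_form_volume_form\<close>). The curvature form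
  \<open>d\<theta> + \<theta> \<and> \<theta>\<close> has the nonzero entry \<open>- \<omega>\<^sup>1 \<and> cnj \<omega>\<^sup>4 + \<omega>\<^sup>4 \<and> cnj \<omega>\<^sup>1\<close> in row 1 and column 2
  (\<open>coframe_curvature\<close>), so \<open>g\<close> is not flat.

  Two points connect this computation with the manifold \<open>\<Gamma> \ G\<close>. Its charts are charts of \<open>G\<close> on
  sheets of the projection, and their changes of coordinates are locally left translations by elements
  of \<open>\<Gamma>\<close> (\<open>quotient_transition\<close>); therefore left-invariant forms descend. And the \<open>\<omega>\<^sup>k\<close> really form
  a coframe at every point: a linear relation at one point would spread to all of \<open>G\<close> by left
  translation and contradict the uniqueness of coefficients in the basis (\<open>bij_coframe_of\<close>).\<close>

section \<open>Calculus of smooth maps\<close>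

lemma dderiv_eqI: "(f has_derivative f') (at x) \<Longrightarrow> dderiv f x u = f' u"
  by (simp add: frechet_derivative_at[symmetric])

lemma times_differentiable_on_cong:
  assumes "open S" "\<And>x. x \<in> S \<Longrightarrow> f x = g x"
  shows "times_differentiable_on n S f \<longleftrightarrow> times_differentiable_on n S g"
  using assms(2)
proof (induction n arbitrary: f g)
  case 0
  then show ?case by (simp cong: continuous_on_cong)
next
  case (Suc n)
  have *: "(f has_derivative f') (at x) \<longleftrightarrow> (g has_derivative f') (at x)" if "x \<in> S" for x f'
    using Suc.prems has_derivative_transform_within_open[OF _ assms(1) that] by metis
  then have "\<forall>x\<in>S. f differentiable at x \<longleftrightarrow> g differentiable at x"
    by (simp add: differentiable_def)
  moreover have "\<forall>x\<in>S. frechet_derivative f (at x) = frechet_derivative g (at x)"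
    using * by (simp add: frechet_derivative_def)
  ultimately show ?case
    using Suc.IH[of "\<lambda>x. dderiv f x u" "\<lambda>x. dderiv g x u" for u] by simp
qed

lemma smooth_on_cong:
  "open S \<Longrightarrow> (\<And>x. x \<in> S \<Longrightarrow> f x = g x) \<Longrightarrow> smooth_on S f \<longleftrightarrow> smooth_on S g"
  unfolding smooth_on_def using times_differentiable_on_cong by metis

lemma times_differentiable_on_Suc_imp:
  "times_differentiable_on (Suc n) S f \<Longrightarrow> times_differentiable_on n S f"
proof (induction n arbitrary: f)
  case 0
  then show ?case
    by (simp add: continuous_at_imp_continuous_on differentiable_imp_continuous_within)
next
  case (Suc n)
  show ?case
    using Suc.prems Suc.IH[of "\<lambda>x. dderiv f x u" for u] by auto
qed

text \<open>The induction step for sums, products, inverses and slices below: a formula for the derivative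
  is exhibited, and its right-hand side is built from functions covered by the induction hypothesis
  by operations already treated.\<close>

lemma times_differentiable_on_SucI:
  assumes "open S" "\<And>x. x \<in> S \<Longrightarrow> (f has_derivative f' x) (at x)"
    and "\<And>u. times_differentiable_on n S (\<lambda>x. f' x u)"
  shows "times_differentiable_on (Suc n) S f"
proof -
  have "dderiv f x u = f' x u" if "x \<in> S" for x u
    by (rule dderiv_eqI[OF assms(2)[OF that]])
  then have "times_differentiable_on n S (\<lambda>x. dderiv f x u)" for u
    using times_differentiable_on_cong[OF assms(1), of "\<lambda>x. dderiv f x u" "\<lambda>x. f' x u"] assms(3)
    by simp
  then show ?thesis
    using assms(2) by (auto simp: differentiable_def)
qed

lemma times_differentiable_on_has_derivative:
  "times_differentiable_on (Suc n) S f \<Longrightarrow> x \<in> S \<Longrightarrow> (f has_derivative dderiv f x) (at x)"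
  by (simp add: frechet_derivative_works)

lemma smooth_on_has_derivative:
  "smooth_on S f \<Longrightarrow> x \<in> S \<Longrightarrow> (f has_derivative dderiv f x) (at x)"
  unfolding smooth_on_def by (meson times_differentiable_on_has_derivative)

lemma smooth_on_differentiable: "smooth_on S f \<Longrightarrow> x \<in> S \<Longrightarrow> f differentiable at x"
  using smooth_on_has_derivative by (auto simp: differentiable_def)

lemma smooth_on_dderiv: "smooth_on S f \<Longrightarrow> smooth_on S (\<lambda>x. dderiv f x u)"
  unfolding smooth_on_def by (metis times_differentiable_on.simps(2))

lemma times_differentiable_on_const: "open S \<Longrightarrow> times_differentiable_on n S (\<lambda>x. c)"
  by (induction n arbitrary: c)
    (auto intro!: times_differentiable_on_SucI[where f' = "\<lambda>x u. 0"] simp del: times_differentiable_on.simps(2))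

lemma times_differentiable_on_bounded_linear:
  assumes "open S" "bounded_linear L" "times_differentiable_on n S f"
  shows "times_differentiable_on n S (\<lambda>x. L (f x))"
  using assms(3)
proof (induction n arbitrary: f)
  case 0
  then show ?case
    using assms(2) by (simp add: bounded_linear.continuous_on)
next
  case (Suc n)
  show ?case
  proof (rule times_differentiable_on_SucI[OF assms(1)])
    show "((\<lambda>x. L (f x)) has_derivative (\<lambda>u. L (dderiv f x u))) (at x)" if "x \<in> S" for x
      by (rule bounded_linear.has_derivative[OF assms(2)
            times_differentiable_on_has_derivative[OF Suc.prems that]])
    show "times_differentiable_on n S (\<lambda>x. L (dderiv f x u))" for u
      using Suc by simp
  qed
qed

lemma times_differentiable_on_add:
  assumes "open S" "times_differentiable_on n S f" "times_differentiable_on n S g"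
  shows "times_differentiable_on n S (\<lambda>x. f x + g x)"
  using assms(2,3)
proof (induction n arbitrary: f g)
  case 0
  then show ?case by (simp add: continuous_on_add)
next
  case (Suc n)
  show ?case
  proof (rule times_differentiable_on_SucI[OF assms(1)])
    show "((\<lambda>x. f x + g x) has_derivative (\<lambda>u. dderiv f x u + dderiv g x u)) (at x)"
      if "x \<in> S" for x
      using Suc.prems[THEN times_differentiable_on_has_derivative, OF that]
      by (intro has_derivative_add)
    show "times_differentiable_on n S (\<lambda>x. dderiv f x u + dderiv g x u)" for u
      using Suc by simp
  qed
qed

lemma times_differentiable_on_bilinear:
  assumes "open S" "bounded_bilinear b" "times_differentiable_on n S f" "times_differentiable_on n S g"
  shows "times_differentiable_on n S (\<lambda>x. b (f x) (g x))"
  using assms(3,4)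
proof (induction n arbitrary: f g)
  case 0
  then show ?case
    by (simp add: bounded_bilinear.continuous_on[OF assms(2)])
next
  case (Suc n)
  show ?case
  proof (rule times_differentiable_on_SucI[OF assms(1)])
    show "((\<lambda>x. b (f x) (g x)) has_derivative
        (\<lambda>u. b (f x) (dderiv g x u) + b (dderiv f x u) (g x))) (at x)" if "x \<in> S" for x
      using Suc.prems[THEN times_differentiable_on_has_derivative, OF that]
      by (intro bounded_bilinear.FDERIV[OF assms(2)])
    show "times_differentiable_on n S (\<lambda>x. b (f x) (dderiv g x u) + b (dderiv f x u) (g x))" for u
      using Suc.prems by (intro times_differentiable_on_add assms Suc.IH)
        (simp_all add: times_differentiable_on_Suc_imp del: times_differentiable_on.simps(2),
         simp_all)
  qed
qed

lemma times_differentiable_on_inverse: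
  fixes f :: "'e::euclidean_space \<Rightarrow> real"
  assumes "open S" "times_differentiable_on n S f" "\<And>x. x \<in> S \<Longrightarrow> f x \<noteq> 0"
  shows "times_differentiable_on n S (\<lambda>x. inverse (f x))"
  using assms(2)
proof (induction n)
  case 0
  then show ?case
    using assms(3) by (simp add: continuous_on_inverse)
next
  case (Suc n)
  have IH: "times_differentiable_on n S (\<lambda>x. inverse (f x))"
    using Suc times_differentiable_on_Suc_imp by blast
  show ?case
  proof (rule times_differentiable_on_SucI[OF assms(1)])
    show "((\<lambda>x. inverse (f x)) has_derivative
        (\<lambda>u. - (inverse (f x) * (dderiv f x u) * inverse (f x)))) (at x)" if "x \<in> S" for x
      by (intro Deriv.has_derivative_inverse assms(3) that
          times_differentiable_on_has_derivative[OF Suc.prems that])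
    show "times_differentiable_on n S (\<lambda>x. - (inverse (f x) * (dderiv f x u) * inverse (f x)))" for u
      using Suc.prems
      by (intro times_differentiable_on_bounded_linear[OF assms(1) bounded_linear_minus[OF bounded_linear_ident]]
          times_differentiable_on_bilinear[OF assms(1) bounded_bilinear_mult] IH) simp
  qed
qed

lemma smooth_on_const: "open S \<Longrightarrow> smooth_on S (\<lambda>x. c)"
  by (simp add: smooth_on_def times_differentiable_on_const)

lemma smooth_on_bounded_linear:
  "open S \<Longrightarrow> bounded_linear L \<Longrightarrow> smooth_on S f \<Longrightarrow> smooth_on S (\<lambda>x. L (f x))"
  by (simp add: smooth_on_def times_differentiable_on_bounded_linear)

lemma smooth_on_add:
  "open S \<Longrightarrow> smooth_on S f \<Longrightarrow> smooth_on S g \<Longrightarrow> smooth_on S (\<lambda>x. f x + g x)"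
  by (simp add: smooth_on_def times_differentiable_on_add)

lemma smooth_on_bilinear:
  "open S \<Longrightarrow> bounded_bilinear b \<Longrightarrow> smooth_on S f \<Longrightarrow> smooth_on S g \<Longrightarrow>
   smooth_on S (\<lambda>x. b (f x) (g x))"
  by (simp add: smooth_on_def times_differentiable_on_bilinear)

lemma smooth_on_inverse:
  fixes f :: "'e::euclidean_space \<Rightarrow> real"
  shows "open S \<Longrightarrow> smooth_on S f \<Longrightarrow> (\<And>x. x \<in> S \<Longrightarrow> f x \<noteq> 0) \<Longrightarrow> smooth_on S (\<lambda>x. inverse (f x))"
  by (simp add: smooth_on_def times_differentiable_on_inverse)

lemma smooth_on_sum:
  "open S \<Longrightarrow> (\<And>i. i \<in> I \<Longrightarrow> smooth_on S (f i)) \<Longrightarrow> smooth_on S (\<lambda>x. \<Sum>i\<in>I. f i x)"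
  by (induction I rule: infinite_finite_induct) (auto intro: smooth_on_const smooth_on_add)

lemma smooth_on_prod:
  fixes f :: "'i \<Rightarrow> 'e::euclidean_space \<Rightarrow> 'f::real_normed_field"
  shows "open S \<Longrightarrow> (\<And>i. i \<in> I \<Longrightarrow> smooth_on S (f i)) \<Longrightarrow> smooth_on S (\<lambda>x. \<Prod>i\<in>I. f i x)"
  by (induction I rule: infinite_finite_induct)
    (auto intro: smooth_on_const smooth_on_bilinear[OF _ bounded_bilinear_mult])

text \<open>Inserting one coordinate is a bounded linear map, and a vector is the sum of its inserted
  coordinates.\<close>

lemma smooth_on_vec:
  fixes f :: "'e::euclidean_space \<Rightarrow> 'f::real_normed_vector ^ 'n"
  assumes "open S" "\<And>i. smooth_on S (\<lambda>x. f x $ i)"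
  shows "smooth_on S f"
proof -
  have "f = (\<lambda>x. \<Sum>i\<in>UNIV. axis i (f x $ i))"
    by (simp add: fun_eq_iff vec_eq_iff axis_def sum.delta)
  moreover have "smooth_on S (\<lambda>x. \<Sum>i\<in>UNIV. axis i (f x $ i))"
  proof (rule smooth_on_sum[OF assms(1)])
    fix i :: 'n
    have "norm (axis i y :: 'f^'n) = norm y" for y
      by (simp add: norm_vec_def L2_set_def axis_def if_distrib[of norm] if_distrib[of "\<lambda>z. z\<^sup>2"]
          sum.delta cong: if_cong)
    then have "bounded_linear (axis i :: 'f \<Rightarrow> 'f^'n)"
      by (intro bounded_linear_intro[where K = 1]) (auto simp: vec_eq_iff axis_def)
    then show "smooth_on S (\<lambda>x. axis i (f x $ i) :: 'f^'n)"
      by (rule smooth_on_bounded_linear[OF assms(1) _ assms(2)])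
  qed
  ultimately show ?thesis by simp
qed

lemma smooth_on_det:
  fixes M :: "'e::euclidean_space \<Rightarrow> ('f::real_normed_field)^'n^'n"
  assumes "open S" "\<And>i j. smooth_on S (\<lambda>x. M x $ i $ j)"
  shows "smooth_on S (\<lambda>x. det (M x))"
  unfolding det_def
  by (intro smooth_on_sum smooth_on_bilinear[OF assms(1) bounded_bilinear_mult] smooth_on_prod
      smooth_on_const assms)

text \<open>Cramer's rule turns the solution of a linear system into a quotient of polynomials in its
  coefficients and its right-hand side.\<close>

lemma smooth_on_solve:
  fixes M :: "'e::euclidean_space \<Rightarrow> real^'n^'n" and b s :: "'e \<Rightarrow> real^'n"
  assumes S: "open S"
    and M: "\<And>i j. smooth_on S (\<lambda>x. M x $ i $ j)" and b: "\<And>i. smooth_on S (\<lambda>x. b x $ i)"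
    and det: "\<And>x. x \<in> S \<Longrightarrow> det (M x) \<noteq> 0"
    and s: "\<And>x. x \<in> S \<Longrightarrow> M x *v s x = b x"
  shows "smooth_on S s"
proof (rule smooth_on_vec[OF S])
  fix k
  let ?N = "\<lambda>x. \<chi> i j. if j = k then b x $ i else M x $ i $ j"
  have "smooth_on S (\<lambda>x. det (?N x) * inverse (det (M x)))"
  proof (intro smooth_on_bilinear[OF S bounded_bilinear_mult] smooth_on_inverse S smooth_on_det M det)
    fix i j
    show "smooth_on S (\<lambda>x. ?N x $ i $ j)"
      using M b by (cases "j = k") simp_all
  qed
  moreover have "s x $ k = det (?N x) * inverse (det (M x))" if "x \<in> S" for x
    using cramer[OF det[OF that], of "s x" "b x"] s[OF that] by (simp add: divide_inverse)
  ultimately show "smooth_on S (\<lambda>x. s x $ k)"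
    using smooth_on_cong[OF S] by (metis (no_types, lifting))
qed

lemma times_differentiable_on_subset:
  "times_differentiable_on n S f \<Longrightarrow> T \<subseteq> S \<Longrightarrow> times_differentiable_on n T f"
proof (induction n arbitrary: f)
  case 0
  then show ?case by (auto intro: continuous_on_subset)
next
  case (Suc n)
  then show ?case by (metis subsetD times_differentiable_on.simps(2))
qed

lemma smooth_on_subset: "smooth_on S f \<Longrightarrow> T \<subseteq> S \<Longrightarrow> smooth_on T f"
  unfolding smooth_on_def using times_differentiable_on_subset by blast

lemma times_differentiable_on_local:
  assumes "\<And>x. x \<in> S \<Longrightarrow> \<exists>N. open N \<and> x \<in> N \<and> times_differentiable_on n N f"
  shows "times_differentiable_on n S f"
  using assms
proof (induction n arbitrary: f)
  case 0
  then show ?case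
    by (metis continuous_at_imp_continuous_on continuous_on_eq_continuous_at times_differentiable_on.simps(1))
next
  case (Suc n)
  have "\<exists>N. open N \<and> x \<in> N \<and> times_differentiable_on n N (\<lambda>x. dderiv f x u)" if "x \<in> S" for x u
    using Suc.prems[OF that] by auto
  then show ?case
    using Suc.prems Suc.IH[of "\<lambda>x. dderiv f x u" for u] by force
qed

lemma smooth_on_local:
  assumes "\<And>x. x \<in> S \<Longrightarrow> \<exists>N. open N \<and> x \<in> N \<and> smooth_on N f"
  shows "smooth_on S f"
  using assms unfolding smooth_on_def by (intro allI times_differentiable_on_local) metis

text \<open>The derivative of the slice is again a slice of a derivative, namely of the one in the direction
  \<open>(0, u)\<close>. This gives the smoothness of left translations from that of the multiplication.\<close>

lemma times_differentiable_on_slice: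
  fixes f :: "'e::euclidean_space \<times> 'f::euclidean_space \<Rightarrow> 'g::real_normed_vector"
  assumes "open T" "\<And>y. y \<in> T \<Longrightarrow> (a, y) \<in> S" "times_differentiable_on n S f"
  shows "times_differentiable_on n T (\<lambda>y. f (a, y))"
  using assms(3)
proof (induction n arbitrary: f)
  case 0
  then have "continuous_on ((\<lambda>y. (a, y)) ` T) f"
    using assms(2) by (auto intro: continuous_on_subset)
  then show ?case
    using continuous_on_compose2[of _ f T "\<lambda>y. (a, y)"] by (simp add: continuous_on_Pair)
next
  case (Suc n)
  show ?case
  proof (rule times_differentiable_on_SucI[OF assms(1)])
    show "((\<lambda>y. f (a, y)) has_derivative (\<lambda>u. dderiv f (a, y) (0, u))) (at y)" if "y \<in> T" for y
      by (rule has_derivative_compose[of "\<lambda>y. (a, y)",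
            OF _ times_differentiable_on_has_derivative[OF Suc.prems assms(2)[OF that]]])
        (auto intro!: derivative_eq_intros)
    show "times_differentiable_on n T (\<lambda>y. dderiv f (a, y) (0, u))" for u
      using Suc.IH[of "\<lambda>p. dderiv f p (0, u)"] Suc.prems by simp
  qed
qed

lemma smooth_on_slice:
  "open T \<Longrightarrow> (\<And>y. y \<in> T \<Longrightarrow> (a, y) \<in> S) \<Longrightarrow> smooth_on S f \<Longrightarrow> smooth_on T (\<lambda>y. f (a, y))"
  unfolding smooth_on_def by (blast intro: times_differentiable_on_slice)

lemma DERIV_along_line:
  fixes f :: "'e::euclidean_space \<Rightarrow> real"
  assumes "smooth_on S f" "x + s *\<^sub>R u \<in> S"
  shows "((\<lambda>s. f (x + s *\<^sub>R u)) has_real_derivative dderiv f (x + s *\<^sub>R u) u) (at s)"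
proof -
  have "((\<lambda>s. f (x + s *\<^sub>R u)) has_derivative (\<lambda>t. dderiv f (x + s *\<^sub>R u) (t *\<^sub>R u))) (at s)"
    by (rule has_derivative_compose[of "\<lambda>s. x + s *\<^sub>R u", OF _ smooth_on_has_derivative[OF assms]])
      (auto intro!: derivative_eq_intros)
  moreover have "linear (dderiv f (x + s *\<^sub>R u))"
    using smooth_on_differentiable[OF assms] by (rule linear_frechet_derivative)
  ultimately show ?thesis
    by (simp add: has_field_derivative_def linear_cmul mult.commute[of _ "dderiv f (x + s *\<^sub>R u) u"])
qed

text \<open>The mean value theorem, applied first along \<open>u\<close> and then along \<open>v\<close>. The left-hand side is
  symmetric in \<open>u\<close> and \<open>v\<close>, so the second derivative in one order at some point close to \<open>x\<close>
  equals the one in the other order at another such point; by continuity they agree at \<open>x\<close>.\<close>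

lemma second_difference_mean_value:
  fixes f :: "'e::euclidean_space \<Rightarrow> real"
  assumes f: "smooth_on S f" and "h > 0"
    and S: "\<And>s t. s \<in> {0..h} \<Longrightarrow> t \<in> {0..h} \<Longrightarrow> x + s *\<^sub>R u + t *\<^sub>R v \<in> S"
  shows "\<exists>s\<in>{0..h}. \<exists>t\<in>{0..h}.
    f (x + h *\<^sub>R u + h *\<^sub>R v) - f (x + h *\<^sub>R u) - f (x + h *\<^sub>R v) + f x
      = h * (h * dderiv (\<lambda>y. dderiv f y u) (x + s *\<^sub>R u + t *\<^sub>R v) v)"
proof -
  define G where "G s = f (x + h *\<^sub>R v + s *\<^sub>R u) - f (x + s *\<^sub>R u)" for s
  have "(G has_real_derivative
      dderiv f (x + h *\<^sub>R v + s *\<^sub>R u) u - dderiv f (x + s *\<^sub>R u) u) (at s)"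
    if "0 \<le> s" "s \<le> h" for s
    unfolding G_def using S[of s h] S[of s 0] that \<open>h > 0\<close>
    by (intro DERIV_diff DERIV_along_line[OF f]) (simp_all add: add_ac)
  from MVT2[OF \<open>h > 0\<close> this] obtain s where s: "0 < s" "s < h"
    and Gh: "G h - G 0 = h * (dderiv f (x + h *\<^sub>R v + s *\<^sub>R u) u - dderiv f (x + s *\<^sub>R u) u)"
    by auto
  have "((\<lambda>t. dderiv f (x + s *\<^sub>R u + t *\<^sub>R v) u) has_real_derivative
      dderiv (\<lambda>y. dderiv f y u) (x + s *\<^sub>R u + t *\<^sub>R v) v) (at t)"
    if "0 \<le> t" "t \<le> h" for t
    using S[of s t] s that by (intro DERIV_along_line[OF smooth_on_dderiv[OF f]]) simp
  from MVT2[OF \<open>h > 0\<close> this] obtain t where t: "0 < t" "t < h"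
    and "dderiv f (x + s *\<^sub>R u + h *\<^sub>R v) u - dderiv f (x + s *\<^sub>R u) u
        = h * dderiv (\<lambda>y. dderiv f y u) (x + s *\<^sub>R u + t *\<^sub>R v) v"
    by auto
  with Gh have "G h - G 0 = h * (h * dderiv (\<lambda>y. dderiv f y u) (x + s *\<^sub>R u + t *\<^sub>R v) v)"
    by (simp add: add_ac)
  moreover have "G h - G 0
      = f (x + h *\<^sub>R u + h *\<^sub>R v) - f (x + h *\<^sub>R u) - f (x + h *\<^sub>R v) + f x"
    by (simp add: G_def add_ac)
  ultimately show ?thesis
    using s t by (intro bexI[of _ s] bexI[of _ t]) simp_all
qed

lemma symmetric_second_derivative_real:
  fixes f :: "'e::euclidean_space \<Rightarrow> real"
  assumes f: "smooth_on S f" and S: "open S" "x \<in> S"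
  shows "dderiv (\<lambda>y. dderiv f y u) x v = dderiv (\<lambda>y. dderiv f y v) x u"
proof -
  define A where "A u v y = dderiv (\<lambda>y. dderiv f y u) y v" for u v y
  have cont: "isCont (A u v) x" for u v
    unfolding A_def
    using smooth_on_differentiable[OF smooth_on_dderiv[OF smooth_on_dderiv[OF f]] S(2)]
      differentiable_imp_continuous_within by blast
  have "\<bar>A u v x - A v u x\<bar> \<le> 0"
  proof (rule field_le_epsilon)
    fix e :: real
    assume "e > 0"
    have near: "\<exists>d>0. \<forall>y. dist y x < d \<longrightarrow> \<bar>A u v y - A u v x\<bar> < e / 2" for u v
      using cont[of u v, unfolded continuous_at_eps_delta dist_real_def, rule_format, of "e / 2"]
        \<open>e > 0\<close> by simp
    obtain r where r: "r > 0" "ball x r \<subseteq> S"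
      using S openE by blast
    obtain d1 d2 where d: "d1 > 0" "d2 > 0"
      "\<And>y. dist y x < d1 \<Longrightarrow> \<bar>A u v y - A u v x\<bar> < e / 2"
      "\<And>y. dist y x < d2 \<Longrightarrow> \<bar>A v u y - A v u x\<bar> < e / 2"
      using near[of u v] near[of v u] by blast
    define d where "d = min r (min d1 d2)"
    define h where "h = d / (2 * (norm u + norm v + 1))"
    have "d > 0" using r d by (simp add: d_def)
    have pos: "norm u + norm v + 1 > 0" by (simp add: add_nonneg_pos)
    then have "h > 0" using \<open>d > 0\<close> by (simp add: h_def)
    have small: "dist (x + s *\<^sub>R u + t *\<^sub>R v) x < d" if "s \<in> {0..h}" "t \<in> {0..h}" for s t
    proof -
      have "dist (x + s *\<^sub>R u + t *\<^sub>R v) x = norm (s *\<^sub>R u + t *\<^sub>R v)"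
        by (simp add: dist_norm add.assoc)
      also have "\<dots> \<le> s * norm u + t * norm v"
        using that norm_triangle_ineq[of "s *\<^sub>R u" "t *\<^sub>R v"] by simp
      also have "\<dots> \<le> h * norm u + h * norm v"
        using that by (intro add_mono mult_right_mono) auto
      also have "\<dots> \<le> h * (norm u + norm v + 1)"
        using \<open>h > 0\<close> by (simp add: distrib_left)
      also have "\<dots> = d / 2"
        using pos by (simp add: h_def field_split_simps)
      finally show ?thesis using \<open>d > 0\<close> by simp
    qed
    have inS: "x + s *\<^sub>R u + t *\<^sub>R v \<in> S" if "s \<in> {0..h}" "t \<in> {0..h}" for s t
      using small[OF that] r by (auto simp: d_def dist_commute subset_iff)
    obtain s t where st: "s \<in> {0..h}" "t \<in> {0..h}"
      "f (x + h *\<^sub>R u + h *\<^sub>R v) - f (x + h *\<^sub>R u) - f (x + h *\<^sub>R v) + f x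
         = h * (h * A u v (x + s *\<^sub>R u + t *\<^sub>R v))"
      using second_difference_mean_value[OF f \<open>h > 0\<close> inS] by (auto simp: A_def)
    have swap: "x + s *\<^sub>R v + t *\<^sub>R u = x + t *\<^sub>R u + s *\<^sub>R v" for s t
      by simp
    obtain s' t' where st': "s' \<in> {0..h}" "t' \<in> {0..h}"
      "f (x + h *\<^sub>R v + h *\<^sub>R u) - f (x + h *\<^sub>R v) - f (x + h *\<^sub>R u) + f x
         = h * (h * A v u (x + s' *\<^sub>R v + t' *\<^sub>R u))"
      using second_difference_mean_value[OF f \<open>h > 0\<close>, of x v u] inS
      unfolding swap A_def by blast
    have "h * (h * A u v (x + s *\<^sub>R u + t *\<^sub>R v)) = h * (h * A v u (x + t' *\<^sub>R u + s' *\<^sub>R v))"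
      using st(3) st'(3) unfolding swap by linarith
    then have "A u v (x + s *\<^sub>R u + t *\<^sub>R v) = A v u (x + t' *\<^sub>R u + s' *\<^sub>R v)"
      using \<open>h > 0\<close> by simp
    moreover have "\<bar>A u v (x + s *\<^sub>R u + t *\<^sub>R v) - A u v x\<bar> < e / 2"
      using small[OF st(1,2)] by (intro d(3)) (simp add: d_def)
    moreover have "\<bar>A v u (x + t' *\<^sub>R u + s' *\<^sub>R v) - A v u x\<bar> < e / 2"
      using small[OF st'(2,1)] by (intro d(4)) (simp add: d_def)
    ultimately show "\<bar>A u v x - A v u x\<bar> \<le> 0 + e" by linarith
  qed
  then show ?thesis by (simp add: A_def)
qed

lemma symmetric_second_derivative:
  fixes f :: "'e::euclidean_space \<Rightarrow> 'f::euclidean_space"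
  assumes f: "smooth_on S f" and S: "open S" "x \<in> S"
  shows "dderiv (\<lambda>y. dderiv f y u) x v = dderiv (\<lambda>y. dderiv f y v) x u"
proof (rule euclidean_eqI)
  fix b :: 'f
  have inner: "dderiv (\<lambda>y. k y \<bullet> b) y u = dderiv k y u \<bullet> b" if "smooth_on S k" "y \<in> S" for k y u
  proof -
    have "((\<lambda>y. k y \<bullet> b) has_derivative (\<lambda>u. dderiv k y u \<bullet> b)) (at y)"
      by (rule has_derivative_inner_left[OF smooth_on_has_derivative[OF that]])
    then show ?thesis by (rule dderiv_eqI)
  qed
  have fb: "smooth_on S (\<lambda>y. f y \<bullet> b)"
    by (rule smooth_on_bounded_linear[OF S(1) bounded_linear_inner_left f])
  have "dderiv (\<lambda>y. dderiv f y u) x v \<bullet> b = dderiv (\<lambda>y. dderiv (\<lambda>y. f y \<bullet> b) y u) x v" for u v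
  proof -
    have "frechet_derivative (\<lambda>y. dderiv f y u \<bullet> b) (at x)
        = frechet_derivative (\<lambda>y. dderiv (\<lambda>y. f y \<bullet> b) y u) (at x)"
      using smooth_on_differentiable[OF smooth_on_bounded_linear[OF S(1) bounded_linear_inner_left
            smooth_on_dderiv[OF f]] S(2)]
      by (rule frechet_derivative_transform_within_open[OF _ S]) (simp add: inner[OF f])
    then show ?thesis
      by (simp add: inner[OF smooth_on_dderiv[OF f] S(2), symmetric])
  qed
  then show "dderiv (\<lambda>y. dderiv f y u) x v \<bullet> b = dderiv (\<lambda>y. dderiv f y v) x u \<bullet> b"
    by (simp add: symmetric_second_derivative_real[OF fb S])
qed

section \<open>Determinants as derivations\<close>

lemma has_derivative_det:
  fixes M :: "'e::real_normed_vector \<Rightarrow> ('f::real_normed_field)^'n^'n"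
  assumes "\<And>i j. ((\<lambda>x. M x $ i $ j) has_derivative (\<lambda>u. M' u $ i $ j)) (at x)"
  shows "((\<lambda>x. det (M x)) has_derivative
    (\<lambda>u. \<Sum>k\<in>UNIV. det (\<chi> i. if i = k then M' u $ i else M x $ i))) (at x)"
proof -
  let ?s = "\<lambda>p. of_int (sign p) :: 'f"
  have "((\<lambda>x. det (M x)) has_derivative (\<lambda>u. \<Sum>p | p permutes UNIV. ?s p *
      (\<Sum>k\<in>UNIV. M' u $ k $ p k * (\<Prod>i\<in>UNIV - {k}. M x $ i $ p i)))) (at x)"
    unfolding det_def
    by (intro has_derivative_sum has_derivative_mult_right has_derivative_prod assms)
  moreover have "(\<Sum>p | p permutes UNIV. ?s p *
      (\<Sum>k\<in>UNIV. M' u $ k $ p k * (\<Prod>i\<in>UNIV - {k}. M x $ i $ p i)))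
    = (\<Sum>k\<in>UNIV. det (\<chi> i. if i = k then M' u $ i else M x $ i))" for u
  proof -
    have "(\<Prod>i\<in>UNIV. (\<chi> i. if i = k then M' u $ i else M x $ i) $ i $ p i)
        = M' u $ k $ p k * (\<Prod>i\<in>UNIV - {k}. M x $ i $ p i)" for k p
      by (subst prod.remove[of _ k]) (auto intro!: prod.cong)
    then show ?thesis
      unfolding det_def sum_distrib_left by (subst sum.swap) simp
  qed
  ultimately show ?thesis by simp
qed

text \<open>Both sides are the derivative of \<open>det\<close> at \<open>A\<close> in the direction \<open>X\<close>, expanded along
  rows and along columns.\<close>

lemma sum_det_replace_row_eq_column:
  fixes A X :: "('f::real_normed_field)^'n^'n"
  shows "(\<Sum>k\<in>UNIV. det (\<chi> i. if i = k then X $ i else A $ i))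
    = (\<Sum>k\<in>UNIV. det (\<chi> i. if i = k then transpose X $ i else transpose A $ i))"
proof -
  have rows: "((\<lambda>t. det (A + t *\<^sub>R X)) has_derivative
      (\<lambda>t. \<Sum>k\<in>UNIV. det (\<chi> i. if i = k then (t *\<^sub>R X) $ i else (A + 0 *\<^sub>R X) $ i))) (at 0)"
    for A X :: "'f^'n^'n"
    by (rule has_derivative_det) (auto intro!: derivative_eq_intros)
  have "det (transpose A + t *\<^sub>R transpose X) = det (A + t *\<^sub>R X)" for t
  proof -
    have "transpose A + t *\<^sub>R transpose X = transpose (A + t *\<^sub>R X)"
      by (simp add: transpose_def vec_eq_iff)
    then show ?thesis by (simp add: det_transpose)
  qed
  then have "((\<lambda>t. det (A + t *\<^sub>R X)) has_derivative (\<lambda>t. \<Sum>k\<in>UNIV.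
      det (\<chi> i. if i = k then (t *\<^sub>R transpose X) $ i else (transpose A + 0 *\<^sub>R transpose X) $ i)))
      (at 0)"
    using rows[of "transpose A" "transpose X"] by simp
  from fun_cong[OF has_derivative_unique[OF rows this], of 1] show ?thesis
    by (simp cong: if_cong)
qed

text \<open>An entry of \<open>m\<close> off the diagonal contributes a determinant with two equal rows.\<close>

lemma sum_det_replace_row_matrix:
  fixes A m :: "('f::field)^'n^'n"
  shows "(\<Sum>k\<in>UNIV. det (\<chi> i. if i = k then (m ** A) $ i else A $ i)) = trace m * det A"
proof -
  have "det (\<chi> i. if i = k then (m ** A) $ i else A $ i) = m $ k $ k * det A" for k
  proof -
    have "det (\<chi> i. if i = k then (m ** A) $ i else A $ i)
        = det (\<chi> i. if i = k then \<Sum>l\<in>UNIV. m $ i $ l *s A $ l else A $ i)"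
      by (rule arg_cong[where f = det]) (simp add: vec_eq_iff matrix_matrix_mult_def)
    also have "\<dots> = (\<Sum>l\<in>UNIV. det (\<chi> i. if i = k then m $ i $ l *s A $ l else A $ i))"
      by (rule det_linear_row_sum) simp
    also have "\<dots> = (\<Sum>l\<in>UNIV. m $ k $ l * det (\<chi> i. if i = k then A $ l else A $ i))"
      using det_row_mul[of k "m $ k $ l" "\<lambda>i. A $ l" "\<lambda>i. A $ i" for l]
      by (intro sum.cong refl) (simp cong: if_cong)
    also have "\<dots> = (\<Sum>l\<in>UNIV. if l = k then m $ k $ k * det A else 0)"
    proof (intro sum.cong refl)
      fix l
      have "(\<chi> i. if i = k then A $ k else A $ i) = A"
        by (simp add: vec_eq_iff)
      moreover have "det (\<chi> i. if i = k then A $ l else A $ i) = 0" if "l \<noteq> k"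
        using that by (intro det_identical_rows[OF that]) (simp add: row_def vec_eq_iff)
      ultimately show "m $ k $ l * det (\<chi> i. if i = k then A $ l else A $ i)
          = (if l = k then m $ k $ k * det A else 0)"
        by auto
    qed
    finally show ?thesis by simp
  qed
  then show ?thesis by (simp add: trace_def sum_distrib_right)
qed

text \<open>An endomorphism \<open>m\<close> acts on the volume form as a derivation by its trace.\<close>

lemma sum_det_replace_row_apply:
  fixes m :: "('f::real_normed_field)^'n^'n" and a :: "'n \<Rightarrow> 'f^'n"
  shows "(\<Sum>k\<in>UNIV. det (\<chi> i. if i = k then m *v a i else a i)) = trace m * det (\<chi> i. a i)"
proof -
  let ?A = "\<chi> i. a i"
  have "(\<Sum>k\<in>UNIV. det (\<chi> i. if i = k then m *v a i else a i))
      = (\<Sum>k\<in>UNIV. det (\<chi> i. if i = k then (\<chi> i. m *v a i) $ i else ?A $ i))"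
    by (simp cong: if_cong)
  also have "\<dots> = (\<Sum>k\<in>UNIV. det (\<chi> i. if i = k then (m ** transpose ?A) $ i else transpose ?A $ i))"
  proof -
    have "transpose (\<chi> i. m *v a i) = m ** transpose ?A"
      by (simp add: transpose_def vec_eq_iff matrix_matrix_mult_def matrix_vector_mult_def)
    then show ?thesis by (subst sum_det_replace_row_eq_column) (simp cong: if_cong)
  qed
  finally show ?thesis
    by (simp add: sum_det_replace_row_matrix det_transpose)
qed

section \<open>Connections with constant coefficients in a coframe\<close>

lemma linear_inv_into:
  fixes f :: "'e::real_vector \<Rightarrow> 'w::real_vector"
  assumes "linear f" "bij f"
  shows "linear (inv_into UNIV f)"
proof -
  have f: "f (inv_into UNIV f a) = a" for a
    using assms(2) by (simp add: bij_def surj_f_inv_f)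
  have "inj f"
    using assms(2) by (simp add: bij_def)
  then show ?thesis
    by (intro linearI; elim injD) (simp_all add: f linear_add[OF assms(1)] linear_cmul[OF assms(1)])
qed

text \<open>The definite subspaces are carried over by the inverse isomorphism.\<close>

lemma has_signature_pullback:
  fixes f :: "'e::euclidean_space \<Rightarrow> 'w::euclidean_space"
  assumes f: "linear f" "bij f" and b: "has_signature b p q"
  shows "has_signature (\<lambda>u v. b (f u) (f v)) p q"
proof -
  obtain P N where PN: "subspace P" "subspace N" "dim P = p" "dim N = q" "p + q = DIM('w)"
    and pos: "\<And>u. u \<in> P \<Longrightarrow> u \<noteq> 0 \<Longrightarrow> b u u > 0" and neg: "\<And>u. u \<in> N \<Longrightarrow> u \<noteq> 0 \<Longrightarrow> b u u < 0"
    using b by (auto simp: has_signature_def)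
  have inj: "inj f" and surj: "surj f"
    using f(2) by (auto simp: bij_def)
  have lin: "linear (inv_into UNIV f)"
    by (rule linear_inv_into[OF f])
  have "inj (inv_into UNIV f)"
    using surj by (rule surj_imp_inj_inv)
  then have dim: "dim (inv_into UNIV f ` S) = dim S" for S
    using dim_image_eq[OF lin, of S] by (simp add: inj_on_subset)
  have "DIM('w) = DIM('e)"
    using dim_image_eq[OF f(1), of UNIV] surj inj by (simp add: inj_on_subset)
  moreover have "f u \<in> S" "f u \<noteq> 0" if "u \<in> inv_into UNIV f ` S" "u \<noteq> 0" for u S
    using that surj linear_injective_0[OF f(1)] inj by (auto simp: surj_f_inv_f)
  ultimately have "p + q = DIM('e) \<and> subspace (inv_into UNIV f ` P) \<and> subspace (inv_into UNIV f ` N) \<and>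
      dim (inv_into UNIV f ` P) = p \<and> dim (inv_into UNIV f ` N) = q \<and>
      (\<forall>u\<in>inv_into UNIV f ` P. u \<noteq> 0 \<longrightarrow> b (f u) (f u) > 0) \<and>
      (\<forall>u\<in>inv_into UNIV f ` N. u \<noteq> 0 \<longrightarrow> b (f u) (f u) < 0)"
    using PN pos neg by (metis dim linear_subspace_image[OF lin])
  then show ?thesis
    unfolding has_signature_def by blast
qed

text \<open>A manifold with a global coframe with values in a model space \<open>'w\<close>. In such a frame, geometric
  structures with constant coefficients are plain algebra on \<open>'w\<close>.\<close>

locale coframed_atlas =
  fixes Q :: "('a, real ^ 'n) chart set"
    and W :: "('a, real ^ 'n) chart \<Rightarrow> real ^ 'n \<Rightarrow> real ^ 'n \<Rightarrow> 'w::euclidean_space"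
  assumes inj_chart: "C \<in> Q \<Longrightarrow> inj_on (snd C) (fst C)"
    and open_chart_image: "C \<in> Q \<Longrightarrow> open (chart_image C)"
    and open_overlap: "C \<in> Q \<Longrightarrow> D \<in> Q \<Longrightarrow> open (local_dom id C D)"
    and smooth_transition: "C \<in> Q \<Longrightarrow> D \<in> Q \<Longrightarrow> smooth_on (local_dom id C D) (local_rep id C D)"
    and linear_coframe: "C \<in> Q \<Longrightarrow> x \<in> chart_image C \<Longrightarrow> linear (W C x)"
    and bij_coframe: "C \<in> Q \<Longrightarrow> x \<in> chart_image C \<Longrightarrow> bij (W C x)"
    and smooth_coframe: "C \<in> Q \<Longrightarrow> smooth_on (chart_image C) (\<lambda>x. W C x u)"
    and natural_coframe: "C \<in> Q \<Longrightarrow> D \<in> Q \<Longrightarrow> x \<in> local_dom id C D \<Longrightarrow>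
      W C x u = W D (local_rep id C D x) (tangent_map id C D x u)"
begin

definition frame :: "('a, real ^ 'n) chart \<Rightarrow> real ^ 'n \<Rightarrow> 'w \<Rightarrow> real ^ 'n"
  where "frame C x = inv_into UNIV (W C x)"

text \<open>The connection for which the frame fields satisfy \<open>\<nabla>\<^sub>a E\<^sub>b = B a b\<close>: for a vector field \<open>V\<close> with
  constant components, \<open>W (\<nabla>\<^sub>u V) = \<partial>\<^sub>u (W V) + B (W u) (W V)\<close>.\<close>

definition connection :: "('w \<Rightarrow> 'w \<Rightarrow> 'w) \<Rightarrow> ('a, real ^ 'n) conn"
  where "connection B C x u v = frame C x (dderiv (\<lambda>y. W C y v) x u + B (W C x u) (W C x v))"

lemma coframe_frame: "C \<in> Q \<Longrightarrow> x \<in> chart_image C \<Longrightarrow> W C x (frame C x b) = b"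
  using bij_coframe by (simp add: frame_def bij_def surj_f_inv_f)

lemma frame_coframe: "C \<in> Q \<Longrightarrow> x \<in> chart_image C \<Longrightarrow> frame C x (W C x u) = u"
  using bij_coframe by (simp add: frame_def bij_def)

lemma coframe_eqI: "C \<in> Q \<Longrightarrow> x \<in> chart_image C \<Longrightarrow> W C x u = W C x v \<Longrightarrow> u = v"
  using frame_coframe by metis

lemma coframe_connection:
  "C \<in> Q \<Longrightarrow> x \<in> chart_image C \<Longrightarrow>
   W C x (connection B C x u v) = dderiv (\<lambda>y. W C y v) x u + B (W C x u) (W C x v)"
  by (simp add: connection_def coframe_frame)

lemma linear_frame: "C \<in> Q \<Longrightarrow> x \<in> chart_image C \<Longrightarrow> linear (frame C x)"
  unfolding frame_def by (intro linear_inv_into linear_coframe bij_coframe)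

lemma coframe_expand:
  assumes "C \<in> Q" "x \<in> chart_image C"
  shows "W C x v = (\<Sum>i\<in>UNIV. v $ i *\<^sub>R W C x (axis i 1))"
proof -
  interpret linear "W C x" by (rule linear_coframe[OF assms])
  have "W C x v = W C x (\<Sum>i\<in>UNIV. v $ i *\<^sub>R axis i 1)"
    using basis_expansion[of v] by (simp add: scalar_mult_eq_scaleR)
  then show ?thesis by (simp add: sum scale)
qed

text \<open>The equation \<open>W v = b\<close> implies \<open>W\<^sup>T W v = W\<^sup>T b\<close>, whose coefficient matrix is the Gram matrix of
  the coframe: square, smooth and invertible.\<close>

lemma smooth_frame:
  assumes C: "C \<in> Q" and b: "smooth_on (chart_image C) b"
  shows "smooth_on (chart_image C) (\<lambda>x. frame C x (b x))"
proof (rule smooth_on_solve[OF open_chart_image[OF C]])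
  let ?e = "\<lambda>i. axis i 1 :: real ^ 'n"
  let ?M = "\<lambda>x. \<chi> i j. W C x (?e i) \<bullet> W C x (?e j)"
  note bilin = smooth_on_bilinear[OF open_chart_image[OF C] bounded_bilinear_inner]
  show "smooth_on (chart_image C) (\<lambda>x. ?M x $ i $ j)" for i j
    using bilin[OF smooth_coframe[OF C] smooth_coframe[OF C]] by simp
  show "smooth_on (chart_image C) (\<lambda>x. (\<chi> i. W C x (?e i) \<bullet> b x) $ i)" for i
    using bilin[OF smooth_coframe[OF C] b] by simp
  have apply_M: "?M x *v v = (\<chi> i. W C x (?e i) \<bullet> W C x v)" if "x \<in> chart_image C" for x v
    unfolding coframe_expand[OF C that, of v]
    by (simp add: vec_eq_iff matrix_vector_mult_def inner_sum_right mult.commute)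
  show "det (?M x) \<noteq> 0" if x: "x \<in> chart_image C" for x
  proof -
    have "v = 0" if "?M x *v v = 0" for v
    proof -
      have "W C x (?e i) \<bullet> W C x v = 0" for i
        using that apply_M[OF x, of v] by (simp add: vec_eq_iff)
      moreover have "W C x v \<bullet> W C x v = (\<Sum>i\<in>UNIV. v $ i * (W C x (?e i) \<bullet> W C x v))"
        by (subst coframe_expand[OF C x, of v]) (simp add: inner_sum_left)
      ultimately have "W C x v = W C x 0"
        by (simp add: linear_0[OF linear_coframe[OF C x]])
      then show "v = 0"
        by (rule coframe_eqI[OF C x])
    qed
    then have "invertible (?M x)"
      using matrix_left_invertible_ker invertible_left_inverse by blast
    then show ?thesis
      by (simp add: invertible_det_nz)
  qed
  show "?M x *v frame C x (b x) = (\<chi> i. W C x (?e i) \<bullet> b x)" if "x \<in> chart_image C" for x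
    by (simp add: apply_M[OF that] coframe_frame[OF C that])
qed

text \<open>The product and chain rules for \<open>W\<close> evaluated on a varying vector at a varying point. Linearity
  of \<open>W\<close> is known on chart images only, so the expansion in coordinates holds near \<open>x\<close>, which is
  enough.\<close>

lemma coframe_chain_rule:
  assumes C: "C \<in> Q" and x: "\<phi> x \<in> chart_image C"
    and \<phi>: "(\<phi> has_derivative \<phi>') (at x)" and k: "(k has_derivative k') (at x)"
  shows "((\<lambda>y. W C (\<phi> y) (k y)) has_derivative
    (\<lambda>u. dderiv (\<lambda>z. W C z (k x)) (\<phi> x) (\<phi>' u) + W C (\<phi> x) (k' u))) (at x)"
proof -
  let ?E = "\<lambda>i z. W C z (axis i 1)"
  note expand = coframe_expand[OF C]
  have E: "(?E i has_derivative dderiv (?E i) z) (at z)" if "z \<in> chart_image C" for i z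
    by (rule smooth_on_has_derivative[OF smooth_coframe[OF C] that])
  have "((\<lambda>z. \<Sum>i\<in>UNIV. v $ i *\<^sub>R ?E i z) has_derivative
      (\<lambda>u. \<Sum>i\<in>UNIV. v $ i *\<^sub>R dderiv (?E i) (\<phi> x) u)) (at (\<phi> x))" for v :: "real ^ 'n"
    by (intro has_derivative_sum has_derivative_scaleR_right E x)
  then have "((\<lambda>z. W C z v) has_derivative
      (\<lambda>u. \<Sum>i\<in>UNIV. v $ i *\<^sub>R dderiv (?E i) (\<phi> x) u)) (at (\<phi> x))" for v
    by (rule has_derivative_transform_within_open[OF _ open_chart_image[OF C] x]) (rule expand[symmetric])
  then have const: "dderiv (\<lambda>z. W C z v) (\<phi> x) u = (\<Sum>i\<in>UNIV. v $ i *\<^sub>R dderiv (?E i) (\<phi> x) u)"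
    for u v by (rule dderiv_eqI)
  have "((\<lambda>y. k y $ i *\<^sub>R ?E i (\<phi> y)) has_derivative
      (\<lambda>u. k x $ i *\<^sub>R dderiv (?E i) (\<phi> x) (\<phi>' u) + k' u $ i *\<^sub>R ?E i (\<phi> x))) (at x)" for i
    by (intro has_derivative_scaleR has_derivative_compose[OF \<phi> E[OF x]]
        bounded_linear.has_derivative[OF bounded_linear_vec_nth k])
  then have "((\<lambda>y. \<Sum>i\<in>UNIV. k y $ i *\<^sub>R ?E i (\<phi> y)) has_derivative
      (\<lambda>u. \<Sum>i\<in>UNIV. k x $ i *\<^sub>R dderiv (?E i) (\<phi> x) (\<phi>' u) + k' u $ i *\<^sub>R ?E i (\<phi> x))) (at x)"
    by (rule has_derivative_sum)
  then have "((\<lambda>y. \<Sum>i\<in>UNIV. k y $ i *\<^sub>R ?E i (\<phi> y)) has_derivative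
      (\<lambda>u. dderiv (\<lambda>z. W C z (k x)) (\<phi> x) (\<phi>' u) + W C (\<phi> x) (k' u))) (at x)"
    by (simp add: sum.distrib const[of "k x"] expand[OF x, of "k' u" for u])
  moreover have "\<forall>\<^sub>F y in at x. (\<Sum>i\<in>UNIV. k y $ i *\<^sub>R ?E i (\<phi> y)) = W C (\<phi> y) (k y)"
  proof -
    have "(\<phi> \<longlongrightarrow> \<phi> x) (at x)"
      using has_derivative_continuous[OF \<phi>] by (simp add: isCont_def)
    then have "\<forall>\<^sub>F y in at x. \<phi> y \<in> chart_image C"
      using topological_tendstoD open_chart_image[OF C] x by blast
    then show ?thesis by (rule eventually_mono) (rule expand[symmetric])
  qed
  ultimately show ?thesis
    by (rule has_derivative_transform_eventually) (simp_all add: expand[OF x, of "k x"])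
qed

lemmas coframe_product_rule = coframe_chain_rule[where \<phi> = "\<lambda>y. y" and \<phi>' = "\<lambda>u. u", OF _ _ has_derivative_ident]

lemma bilinear_dderiv_coframe:
  assumes C: "C \<in> Q" and x: "x \<in> chart_image C"
  shows "bilinear (\<lambda>u v. dderiv (\<lambda>y. W C y v) x u)"
proof -
  have "linear (\<lambda>u. dderiv (\<lambda>y. W C y v) x u)" for v
    by (rule linear_frechet_derivative[OF smooth_on_differentiable[OF smooth_coframe[OF C] x]])
  moreover have "linear (\<lambda>v. dderiv (\<lambda>y. W C y v) x u)" for u
  proof -
    note d = smooth_on_has_derivative[OF smooth_coframe[OF C] x]
    have "dderiv (\<lambda>y. W C y (v + w)) x = (\<lambda>u. dderiv (\<lambda>y. W C y v) x u + dderiv (\<lambda>y. W C y w) x u)"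
      for v w
    proof (rule frechet_derivative_at[symmetric])
      show "((\<lambda>y. W C y (v + w)) has_derivative
          (\<lambda>u. dderiv (\<lambda>y. W C y v) x u + dderiv (\<lambda>y. W C y w) x u)) (at x)"
        by (rule has_derivative_transform_within_open[OF has_derivative_add[OF d d]
              open_chart_image[OF C] x]) (simp add: linear_add[OF linear_coframe[OF C]])
    qed
    moreover have "dderiv (\<lambda>y. W C y (r *\<^sub>R v)) x = (\<lambda>u. r *\<^sub>R dderiv (\<lambda>y. W C y v) x u)" for r v
    proof (rule frechet_derivative_at[symmetric])
      show "((\<lambda>y. W C y (r *\<^sub>R v)) has_derivative (\<lambda>u. r *\<^sub>R dderiv (\<lambda>y. W C y v) x u)) (at x)"
        by (rule has_derivative_transform_within_open[OF has_derivative_scaleR_right[OF d]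
              open_chart_image[OF C] x]) (simp add: linear_cmul[OF linear_coframe[OF C]])
    qed
    ultimately show ?thesis by (intro linearI) simp_all
  qed
  ultimately show ?thesis by (simp add: bilinear_def)
qed

lemma transition_in_chart_image:
  assumes "C \<in> Q" "x \<in> local_dom id C D"
  shows "x \<in> chart_image C" "local_rep id C D x \<in> chart_image D"
  using assms inj_chart[OF assms(1)]
  by (auto simp: local_dom_def local_rep_def chart_image_def)

text \<open>The transformation law is the derivative of \<open>W\<^sub>C v = W\<^sub>D (T v)\<close>, where \<open>T\<close> is the differential of
  the change of coordinates: the second derivative of that change appears by the product rule.\<close>

lemma affine_connection_connection:
  assumes B: "bilinear B"
  shows "affine_connection Q (connection B)"
  unfolding affine_connection_def
proof (intro conjI ballI allI)
  fix C assume C: "C \<in> Q"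
  show "bilinear (connection B C x)" if x: "x \<in> chart_image C" for x
  proof -
    note bil = bilinear_dderiv_coframe[OF C x]
    have "linear (\<lambda>u. dderiv (\<lambda>y. W C y v) x u + B (W C x u) (W C x v))" for v
      using bil B linear_compose[OF linear_coframe[OF C x], of "\<lambda>z. B z (W C x v)"]
      by (intro linear_compose_add) (simp_all add: bilinear_def o_def)
    moreover have "linear (\<lambda>v. dderiv (\<lambda>y. W C y v) x u + B (W C x u) (W C x v))" for u
      using bil B linear_compose[OF linear_coframe[OF C x], of "B (W C x u)"]
      by (intro linear_compose_add) (simp_all add: bilinear_def o_def)
    ultimately show ?thesis
      unfolding bilinear_def connection_def
      by (intro conjI allI linear_compose[OF _ linear_frame[OF C x], unfolded o_def])
  qed
  show "smooth_on (chart_image C) (\<lambda>x. connection B C x u v)" for u v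
    unfolding connection_def
    by (rule smooth_frame[OF C smooth_on_add[OF open_chart_image[OF C] smooth_on_dderiv[OF smooth_coframe[OF C]]
            smooth_on_bilinear[OF open_chart_image[OF C] B[unfolded bilinear_conv_bounded_bilinear]
              smooth_coframe[OF C] smooth_coframe[OF C]]]])
next
  fix C D x u v assume C: "C \<in> Q" and D: "D \<in> Q" and x: "x \<in> local_dom id C D"
  let ?\<phi> = "local_rep id C D" and ?T = "tangent_map id C D"
  note x' = transition_in_chart_image[OF C x]
  have \<phi>: "(?\<phi> has_derivative ?T x) (at x)"
    by (rule smooth_on_has_derivative[OF smooth_transition[OF C D] x])
  have T: "((\<lambda>y. ?T y v) has_derivative dderiv (\<lambda>y. ?T y v) x) (at x)"
    by (rule smooth_on_has_derivative[OF smooth_on_dderiv[OF smooth_transition[OF C D]] x])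
  have "((\<lambda>y. W C y v) has_derivative
      (\<lambda>u. dderiv (\<lambda>z. W D z (?T x v)) (?\<phi> x) (?T x u) + W D (?\<phi> x) (dderiv (\<lambda>y. ?T y v) x u))) (at x)"
    by (rule has_derivative_transform_within_open[OF coframe_chain_rule[OF D x'(2) \<phi> T]
          open_overlap[OF C D] x]) (simp add: natural_coframe[OF C D])
  then have d: "dderiv (\<lambda>y. W C y v) x u
      = dderiv (\<lambda>z. W D z (?T x v)) (?\<phi> x) (?T x u) + W D (?\<phi> x) (dderiv (\<lambda>y. ?T y v) x u)"
    by (rule dderiv_eqI)
  show "?T x (connection B C x u v) =
      dderiv (\<lambda>y. ?T y v) x u + connection B D (?\<phi> x) (?T x u) (?T x v)"
  proof (rule coframe_eqI[OF D x'(2)])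
    show "W D (?\<phi> x) (?T x (connection B C x u v)) =
        W D (?\<phi> x) (dderiv (\<lambda>y. ?T y v) x u + connection B D (?\<phi> x) (?T x u) (?T x v))"
      by (simp add: natural_coframe[OF C D x, symmetric] coframe_connection[OF C x'(1)] d
          linear_add[OF linear_coframe[OF D x'(2)]] coframe_connection[OF D x'(2)])
  qed
qed

lemma bilinear_field_coframe:
  assumes h: "bilinear h"
  shows "bilinear_field Q (\<lambda>C x u v. h (W C x u) (W C x v))"
  unfolding bilinear_field_def
proof (intro conjI ballI allI)
  fix C assume C: "C \<in> Q"
  show "bilinear (\<lambda>u v. h (W C x u) (W C x v))" if x: "x \<in> chart_image C" for x
    using h unfolding bilinear_def
    by (auto intro!: linear_compose[OF linear_coframe[OF C x], unfolded o_def])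
  show "smooth_on (chart_image C) (\<lambda>x. h (W C x u) (W C x v))" for u v
    by (rule smooth_on_bilinear[OF open_chart_image[OF C] h[unfolded bilinear_conv_bounded_bilinear]
          smooth_coframe[OF C] smooth_coframe[OF C]])
qed (simp add: natural_coframe)

text \<open>Metric compatibility is skewness of \<open>B w\<close> for the constant form \<open>h\<close>, and vanishing torsion is the
  first structure equation \<open>d\<omega> = - \<theta> \<and> \<omega>\<close>, where \<open>\<theta>\<close> is the connection form \<open>B (W _)\<close>.\<close>

lemma levi_civita_connection:
  assumes B: "bilinear B" and h: "bilinear h"
    and skew: "\<And>w z z'. h (B w z) z' + h z (B w z') = 0"
    and torsion_free: "\<And>C x u v. C \<in> Q \<Longrightarrow> x \<in> chart_image C \<Longrightarrow>
      dderiv (\<lambda>y. W C y v) x u - dderiv (\<lambda>y. W C y u) x v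
        = B (W C x v) (W C x u) - B (W C x u) (W C x v)"
  shows "levi_civita Q (\<lambda>C x u v. h (W C x u) (W C x v)) (connection B)"
  unfolding levi_civita_def
proof (intro conjI ballI allI)
  fix C x assume C: "C \<in> Q" and x: "x \<in> chart_image C"
  show "connection B C x u v = connection B C x v u" for u v
    using torsion_free[OF C x, of v u] by (simp add: connection_def algebra_simps)
  show "dderiv (\<lambda>y. h (W C y u) (W C y v)) x w - h (W C x (connection B C x w u)) (W C x v)
      - h (W C x u) (W C x (connection B C x w v)) = 0" for u v w
  proof -
    have "((\<lambda>y. h (W C y u) (W C y v)) has_derivative (\<lambda>w.
        h (W C x u) (dderiv (\<lambda>y. W C y v) x w) + h (dderiv (\<lambda>y. W C y u) x w) (W C x v))) (at x)"
      using h by (intro bounded_bilinear.FDERIV smooth_on_has_derivative[OF smooth_coframe[OF C] x])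
        (simp add: bilinear_conv_bounded_bilinear)
    then have "dderiv (\<lambda>y. h (W C y u) (W C y v)) x w
        = h (W C x u) (dderiv (\<lambda>y. W C y v) x w) + h (dderiv (\<lambda>y. W C y u) x w) (W C x v)"
      by (rule dderiv_eqI)
    then show ?thesis
      using skew[of "W C x w" "W C x u" "W C x v"]
      by (simp add: coframe_connection[OF C x] bilinear_ladd[OF h] bilinear_radd[OF h])
  qed
qed (rule affine_connection_connection[OF B])

text \<open>In the frame \<open>J\<close> is the constant endomorphism \<open>K\<close>. Differentiating \<open>W J = K W\<close> expresses the
  derivative of \<open>J\<close> by those of the coframe, and what remains is the commutator of \<open>B w\<close> and \<open>K\<close>.\<close>

lemma parallel_endo_connection:
  assumes K: "linear K" and B: "\<And>w z. B w (K z) = K (B w z)"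
    and J: "endo_field Q J"
      "\<And>C x u. C \<in> Q \<Longrightarrow> x \<in> chart_image C \<Longrightarrow> W C x (J C x u) = K (W C x u)"
  shows "parallel_endo Q (connection B) J"
  unfolding parallel_endo_def
proof (intro ballI allI)
  fix C x v w assume C: "C \<in> Q" and x: "x \<in> chart_image C"
  have "((\<lambda>y. J C y v) has_derivative dderiv (\<lambda>y. J C y v) x) (at x)"
    using J(1) C by (intro smooth_on_has_derivative[OF _ x]) (simp add: endo_field_def)
  from coframe_product_rule[OF C x this]
  have "((\<lambda>y. K (W C y v)) has_derivative (\<lambda>w. dderiv (\<lambda>z. W C z (J C x v)) x w
      + W C x (dderiv (\<lambda>y. J C y v) x w))) (at x)"
    by (rule has_derivative_transform_within_open[OF _ open_chart_image[OF C] x]) (simp add: J(2)[OF C])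
  moreover have "((\<lambda>y. K (W C y v)) has_derivative (\<lambda>w. K (dderiv (\<lambda>y. W C y v) x w))) (at x)"
    by (rule bounded_linear.has_derivative[OF K[unfolded linear_conv_bounded_linear]
          smooth_on_has_derivative[OF smooth_coframe[OF C] x]])
  ultimately have "dderiv (\<lambda>z. W C z (J C x v)) x w + W C x (dderiv (\<lambda>y. J C y v) x w)
      = K (dderiv (\<lambda>y. W C y v) x w)"
    by (rule fun_cong[OF has_derivative_unique])
  then have "W C x (dderiv (\<lambda>y. J C y v) x w + connection B C x w (J C x v))
      = W C x (J C x (connection B C x w v))"
    by (simp add: linear_add[OF linear_coframe[OF C x]] coframe_connection[OF C x] J(2)[OF C x] B
        linear_add[OF K] algebra_simps)
  then show "dderiv (\<lambda>y. J C y v) x w + connection B C x w (J C x v) - J C x (connection B C x w v) = 0"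
    using coframe_eqI[OF C x] by simp
qed

text \<open>The second structure equation. Differentiating \<open>W (\<nabla>\<^sub>v w) = \<partial>\<^sub>v (W w) + B (W v) (W w)\<close> once more
  and alternating in \<open>u\<close> and \<open>v\<close>, the second derivatives of the coframe cancel by symmetry, and only
  algebra and the exterior derivative of the coframe are left.\<close>

lemma coframe_curvature:
  assumes B: "bilinear B" and C: "C \<in> Q" and x: "x \<in> chart_image C"
  shows "W C x (curvature (connection B) C x u v w)
    = B (W C x u) (B (W C x v) (W C x w)) - B (W C x v) (B (W C x u) (W C x w))
      + B (dderiv (\<lambda>y. W C y v) x u - dderiv (\<lambda>y. W C y u) x v) (W C x w)"
proof -
  have bB: "bounded_bilinear B"
    using B by (simp add: bilinear_conv_bounded_bilinear)
  note dW = smooth_on_has_derivative[OF smooth_coframe[OF C] x]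
  have second: "W C x (dderiv (\<lambda>y. connection B C y v w) x u + connection B C x u (connection B C x v w))
      = dderiv (\<lambda>y. dderiv (\<lambda>y. W C y w) y v) x u + B (dderiv (\<lambda>y. W C y v) x u) (W C x w)
        + B (W C x v) (dderiv (\<lambda>y. W C y w) x u) + B (W C x u) (dderiv (\<lambda>y. W C y w) x v)
        + B (W C x u) (B (W C x v) (W C x w))" for u v
  proof -
    have "((\<lambda>y. connection B C y v w) has_derivative dderiv (\<lambda>y. connection B C y v w) x) (at x)"
      using affine_connection_connection[OF B] C
      by (intro smooth_on_has_derivative[OF _ x]) (simp add: affine_connection_def)
    from coframe_product_rule[OF C x this]
    have "((\<lambda>y. dderiv (\<lambda>y. W C y w) y v + B (W C y v) (W C y w)) has_derivative
        (\<lambda>u. dderiv (\<lambda>z. W C z (connection B C x v w)) x u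
          + W C x (dderiv (\<lambda>y. connection B C y v w) x u))) (at x)"
      by (rule has_derivative_transform_within_open[OF _ open_chart_image[OF C] x])
        (simp add: coframe_connection[OF C])
    moreover have "((\<lambda>y. dderiv (\<lambda>y. W C y w) y v + B (W C y v) (W C y w)) has_derivative
        (\<lambda>u. dderiv (\<lambda>y. dderiv (\<lambda>y. W C y w) y v) x u
          + (B (W C x v) (dderiv (\<lambda>y. W C y w) x u) + B (dderiv (\<lambda>y. W C y v) x u) (W C x w)))) (at x)"
      by (intro has_derivative_add bounded_bilinear.FDERIV[OF bB] dW
          smooth_on_has_derivative[OF smooth_on_dderiv[OF smooth_coframe[OF C]] x])
    ultimately have "dderiv (\<lambda>z. W C z (connection B C x v w)) x u
          + W C x (dderiv (\<lambda>y. connection B C y v w) x u)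
        = dderiv (\<lambda>y. dderiv (\<lambda>y. W C y w) y v) x u
          + (B (W C x v) (dderiv (\<lambda>y. W C y w) x u) + B (dderiv (\<lambda>y. W C y v) x u) (W C x w))"
    by (rule fun_cong[OF has_derivative_unique])
    then show ?thesis
      by (simp add: linear_add[OF linear_coframe[OF C x]] coframe_connection[OF C x]
          bilinear_radd[OF B] algebra_simps)
  qed
  have "curvature (connection B) C x u v w
      = (dderiv (\<lambda>y. connection B C y v w) x u + connection B C x u (connection B C x v w))
        - (dderiv (\<lambda>y. connection B C y u w) x v + connection B C x v (connection B C x u w))"
    by (simp add: curvature_def)
  then show ?thesis
    using symmetric_second_derivative[OF smooth_coframe[OF C] open_chart_image[OF C] x, of w u v]
    by (simp only: linear_diff[OF linear_coframe[OF C x]] second)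
      (simp add: bilinear_lsub[OF B] algebra_simps)
qed

end

section \<open>The complex volume form of a coframe\<close>

definition volume_form :: "(('a, 'e) chart \<Rightarrow> 'e \<Rightarrow> 'e \<Rightarrow> complex ^ 'm) \<Rightarrow> ('a, 'e, 'm::finite) multi_form"
  where "volume_form W C x v = det (\<chi> i. W C x (v i))"

lemma volume_form_update:
  "volume_form W C x (v(k := u)) = det (\<chi> i. if i = k then W C x u else W C x (v i))"
  unfolding volume_form_def by (rule arg_cong[where f = det]) (simp add: vec_eq_iff)

lemma multi_form_volume_form:
  fixes W :: "('a, real ^ 'n) chart \<Rightarrow> real ^ 'n \<Rightarrow> real ^ 'n \<Rightarrow> complex ^ 'm"
  assumes "coframed_atlas Q W"
  shows "multi_form Q (volume_form W)"
proof -
  interpret coframed_atlas Q W by fact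
  show ?thesis
    unfolding multi_form_def
  proof (intro conjI ballI allI impI)
    fix C assume C: "C \<in> Q"
    show "linear (\<lambda>u. volume_form W C x (v(k := u)))" if x: "x \<in> chart_image C" for x v k
    proof (rule linearI)
      note lin = linear_coframe[OF C x]
      show "volume_form W C x (v(k := u + u')) = volume_form W C x (v(k := u)) + volume_form W C x (v(k := u'))" for u u'
        unfolding volume_form_update linear_add[OF lin] by (rule det_row_add)
      show "volume_form W C x (v(k := r *\<^sub>R u)) = r *\<^sub>R volume_form W C x (v(k := u))" for r u
      proof -
        have "W C x (r *\<^sub>R u) = complex_of_real r *s W C x u"
          by (simp add: linear_cmul[OF lin] vec_eq_iff) (simp add: scaleR_conv_of_real)
        then show ?thesis
          unfolding volume_form_update scaleR_conv_of_real by (simp only: det_row_mul)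
      qed
    qed
    show "volume_form W C x v = 0" if "i \<noteq> j \<and> v i = v j" for x v i j
      using that by (auto simp: volume_form_def row_def intro!: det_identical_rows[of i j])
    show "smooth_on (chart_image C) (\<lambda>x. volume_form W C x v)" for v
      unfolding volume_form_def
    proof (rule smooth_on_det[OF open_chart_image[OF C]])
      show "smooth_on (chart_image C) (\<lambda>x. (\<chi> i. W C x (v i)) $ i $ j)" for i j
        unfolding vec_lambda_beta
        by (rule smooth_on_bounded_linear[OF open_chart_image[OF C] bounded_linear_vec_nth smooth_coframe[OF C]])
    qed
  qed (simp add: volume_form_def natural_coframe)
qed

lemma volume_form_nonzero:
  fixes W :: "('a, real ^ 'n) chart \<Rightarrow> real ^ 'n \<Rightarrow> real ^ 'n \<Rightarrow> complex ^ 'm"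
  assumes "coframed_atlas Q W" and C: "C \<in> Q" "x \<in> chart_image C"
  shows "\<exists>v. volume_form W C x v \<noteq> 0"
proof -
  interpret coframed_atlas Q W by fact
  have "(\<chi> i. W C x (frame C x (axis i 1))) = mat 1"
    by (auto simp: coframe_frame[OF C] vec_eq_iff axis_def mat_def)
  then have "volume_form W C x (\<lambda>i. frame C x (axis i 1)) = 1"
    by (simp add: volume_form_def)
  then show ?thesis
    by (intro exI[of _ "\<lambda>i. frame C x (axis i 1)"]) simp
qed

lemma type_p_0_volume_form:
  fixes W :: "('a, 'e) chart \<Rightarrow> 'e \<Rightarrow> 'e \<Rightarrow> complex ^ 'm"
  assumes "\<And>C x u. C \<in> Q \<Longrightarrow> x \<in> chart_image C \<Longrightarrow> W C x (J C x u) = \<i> *s W C x u"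
  shows "type_p_0 Q J (volume_form W)"
  unfolding type_p_0_def
proof (intro ballI allI)
  fix C x k and v :: "'m \<Rightarrow> _" assume C: "C \<in> Q" "x \<in> chart_image C"
  have "(\<chi> i. if i = k then W C x (v k) else W C x (v i)) = (\<chi> i. W C x (v i))"
    by (simp add: vec_eq_iff)
  then show "volume_form W C x v + \<i> * volume_form W C x (v(k := J C x (v k))) = 0"
    using det_row_mul[of k \<i> "\<lambda>i. W C x (v k)" "\<lambda>i. W C x (v i)"]
    unfolding volume_form_update assms[OF C] by (simp add: volume_form_def mult.assoc[symmetric])
qed

text \<open>The derivative of the determinant replaces its rows, one at a time, by \<open>\<partial>\<^sub>w (W (v k))\<close>. The
  connection adds \<open>\<beta> (W w) (W (v k))\<close> to them, which changes the sum by a multiple of the trace.\<close>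

lemma parallel_form_volume_form:
  fixes W :: "('a, real ^ 'n) chart \<Rightarrow> real ^ 'n \<Rightarrow> real ^ 'n \<Rightarrow> complex ^ 'm"
    and \<beta> :: "complex ^ 'm \<Rightarrow> complex ^ 'm ^ 'm"
  assumes "coframed_atlas Q W" and trace: "\<And>w. trace (\<beta> w) = 0"
  shows "parallel_form Q (coframed_atlas.connection W (\<lambda>w z. \<beta> w *v z)) (volume_form W)"
  unfolding parallel_form_def
proof (intro ballI allI)
  interpret coframed_atlas Q W by fact
  let ?D = "connection (\<lambda>w z. \<beta> w *v z)"
  fix C x w and v :: "'m \<Rightarrow> _" assume C: "C \<in> Q" and x: "x \<in> chart_image C"
  let ?dW = "\<lambda>k w. dderiv (\<lambda>y. W C y (v k)) x w"
  have dW: "((\<lambda>y. W C y u $ j) has_derivative (\<lambda>w. dderiv (\<lambda>y. W C y u) x w $ j)) (at x)" for u j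
    by (rule bounded_linear.has_derivative[OF bounded_linear_vec_nth
          smooth_on_has_derivative[OF smooth_coframe[OF C] x]])
  have "((\<lambda>y. det (\<chi> i. W C y (v i))) has_derivative (\<lambda>w. \<Sum>k\<in>UNIV.
      det (\<chi> i. if i = k then (\<chi> i. ?dW i w) $ i else (\<chi> i. W C x (v i)) $ i))) (at x)"
    by (rule has_derivative_det) (simp add: dW)
  then have "dderiv (\<lambda>y. volume_form W C y v) x w = (\<Sum>k\<in>UNIV.
      det (\<chi> i. if i = k then (\<chi> i. ?dW i w) $ i else (\<chi> i. W C x (v i)) $ i))"
    unfolding volume_form_def by (rule dderiv_eqI)
  also have "\<dots> = (\<Sum>k\<in>UNIV. det (\<chi> i. if i = k then ?dW i w else W C x (v i)))"
    by (simp cong: if_cong)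
  \<comment> \<open>The added sum is the trace times the determinant, hence zero.\<close>
  also have "\<dots> = (\<Sum>k\<in>UNIV. det (\<chi> i. if i = k then ?dW i w else W C x (v i)))
      + (\<Sum>k\<in>UNIV. det (\<chi> i. if i = k then \<beta> (W C x w) *v W C x (v i) else W C x (v i)))"
    by (simp add: sum_det_replace_row_apply trace)
  also have "\<dots> = (\<Sum>k\<in>UNIV. volume_form W C x (v(k := ?D C x w (v k))))"
    unfolding sum.distrib[symmetric]
  proof (intro sum.cong refl)
    fix k
    have "volume_form W C x (v(k := ?D C x w (v k)))
        = det (\<chi> i. if i = k then ?dW i w + \<beta> (W C x w) *v W C x (v i) else W C x (v i))"
      unfolding volume_form_update coframe_connection[OF C x]
      by (rule arg_cong[where f = det]) (simp add: vec_eq_iff)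
    then show "det (\<chi> i. if i = k then ?dW i w else W C x (v i))
        + det (\<chi> i. if i = k then \<beta> (W C x w) *v W C x (v i) else W C x (v i))
      = volume_form W C x (v(k := ?D C x w (v k)))"
      by (simp add: det_row_add)
  qed
  finally show "dderiv (\<lambda>y. volume_form W C y v) x w
      - (\<Sum>k\<in>UNIV. volume_form W C x (v(k := ?D C x w (v k)))) = 0"
    by simp
qed

section \<open>Quotients of Lie groups\<close>

locale lie_group_quotient = group G
  for G :: "('g::topological_space) monoid" (structure)
    and A :: "('g, 'e::euclidean_space) chart set" and \<Gamma> :: "'g set" +
  assumes lie: "lie_group G A" and \<Gamma>: "subgroup \<Gamma> G"
begin

lemma in_carrier [simp]: "a \<in> carrier G"
  using lie by (simp add: lie_group_def)

lemma continuous_mult: "continuous_on UNIV (\<lambda>(a, b). a \<otimes> b)"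
  and continuous_inv: "continuous_on UNIV (\<lambda>a. inv a)"
  using lie by (simp_all add: lie_group_def smooth_map_def euclidean_product_topology
      continuous_map_iff_continuous2)

lemma open_translate_vimage:
  assumes "open U"
  shows "open {p. a \<otimes> p \<in> U}"
proof -
  have "continuous_on UNIV (\<lambda>p. (\<lambda>(a, b). a \<otimes> b) (a, p))"
    by (rule continuous_on_compose2[OF continuous_mult]) (auto intro!: continuous_intros)
  then show ?thesis
    using open_vimage[OF assms, of "\<lambda>p. a \<otimes> p"] by (simp add: vimage_def)
qed

lemma
  assumes c: "c \<in> A"
  shows open_chart_dom: "open (fst c)"
    and inj_on_chart: "inj_on (snd c) (fst c)"
    and open_image_chart: "open U \<Longrightarrow> U \<subseteq> fst c \<Longrightarrow> open (snd c ` U)"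
proof -
  have c': "openin euclidean (fst c)" "open (chart_image c)"
    "homeomorphic_map (subtopology euclidean (fst c)) (top_of_set (chart_image c)) (snd c)"
    using lie c by (auto simp: lie_group_def smooth_manifold_def)
  show "open (fst c)" using c'(1) by simp
  show "inj_on (snd c) (fst c)"
    using homeomorphic_imp_injective_map[OF c'(3)] by simp
  assume U: "open U" "U \<subseteq> fst c"
  then have "openin (top_of_set (fst c)) U"
    by (metis open_subset)
  then have "openin (top_of_set (chart_image c)) (snd c ` U)"
    using homeomorphic_imp_open_map[OF c'(3)] by (simp add: open_map_def)
  then show "open (snd c ` U)"
    using c'(2) openin_open_trans by blast
qed

lemma chart_cover: "\<exists>c\<in>A. p \<in> fst c"
  using lie by (auto simp: lie_group_def smooth_manifold_def)

lemma inv_into_chart: "c \<in> A \<Longrightarrow> p \<in> fst c \<Longrightarrow> inv_into (fst c) (snd c) (snd c p) = p"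
  using inj_on_chart by simp

lemma local_dom_translation:
  "local_dom (\<lambda>p. a \<otimes> p) c d = snd c ` (fst c \<inter> {p. a \<otimes> p \<in> fst d})"
  unfolding local_dom_def by (rule arg_cong[where f = "image _"]) blast

lemma open_local_dom_translation:
  "c \<in> A \<Longrightarrow> d \<in> A \<Longrightarrow> open (local_dom (\<lambda>p. a \<otimes> p) c d)"
  unfolding local_dom_translation
  by (intro open_image_chart open_Int open_translate_vimage open_chart_dom) auto

text \<open>Left translation by \<open>a\<close> is the multiplication with its first argument frozen.\<close>

lemma smooth_translation:
  assumes c: "c \<in> A" and d: "d \<in> A"
  shows "smooth_on (local_dom (\<lambda>p. a \<otimes> p) c d) (local_rep (\<lambda>p. a \<otimes> p) c d)"
proof -
  obtain b where b: "b \<in> A" "a \<in> fst b"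
    using chart_cover by blast
  let ?P = "(fst b \<times> fst c, map_prod (snd b) (snd c))"
  let ?m = "\<lambda>(a, b). a \<otimes> b"
  have "?P \<in> product_atlas A A"
    unfolding product_atlas_def using b(1) c
    by (intro CollectI exI[of _ b] exI[of _ c] conjI refl)
  then have m: "smooth_on (local_dom ?m ?P d) (local_rep ?m ?P d)"
    using lie d by (simp add: lie_group_def smooth_map_def)
  have inj: "inj_on (map_prod (snd b) (snd c)) (fst b \<times> fst c)"
    using inj_on_chart[OF b(1)] inj_on_chart[OF c] by (rule map_prod_inj_on)
  have dom: "(snd b a, y) \<in> local_dom ?m ?P d"
    and rep: "local_rep ?m ?P d (snd b a, y) = local_rep (\<lambda>p. a \<otimes> p) c d y"
    if y: "y \<in> local_dom (\<lambda>p. a \<otimes> p) c d" for y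
  proof -
    obtain p where p: "p \<in> fst c" "a \<otimes> p \<in> fst d" "y = snd c p"
      using y by (auto simp: local_dom_def)
    then show "(snd b a, y) \<in> local_dom ?m ?P d"
      using b by (auto simp: local_dom_def intro!: image_eqI[of _ _ "(a, p)"])
    have "inv_into (fst b \<times> fst c) (map_prod (snd b) (snd c)) (snd b a, y) = (a, p)"
      using b p by (intro inv_into_f_eq[OF inj]) auto
    then show "local_rep ?m ?P d (snd b a, y) = local_rep (\<lambda>p. a \<otimes> p) c d y"
      using p inv_into_chart[OF c] by (simp add: local_rep_def)
  qed
  have op: "open (local_dom (\<lambda>p. a \<otimes> p) c d)"
    by (rule open_local_dom_translation[OF c d])
  show ?thesis
    using smooth_on_slice[OF op dom m] smooth_on_cong[OF op rep] by simp
qed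

abbreviation proj :: "'g \<Rightarrow> 'g set"
  where "proj \<equiv> coset_proj G \<Gamma>"

abbreviation quotient :: "('g set, 'e) chart set"
  where "quotient \<equiv> quotient_atlas G \<Gamma> A"

lemma proj_eq_iff: "proj p = proj q \<longleftrightarrow> (\<exists>\<gamma>\<in>\<Gamma>. q = \<gamma> \<otimes> p)"
proof
  assume "proj p = proj q"
  then have "q \<in> proj p"
    using rcos_self[OF _ \<Gamma>, of q] by simp
  then show "\<exists>\<gamma>\<in>\<Gamma>. q = \<gamma> \<otimes> p"
    by (auto simp: r_coset_def)
next
  assume "\<exists>\<gamma>\<in>\<Gamma>. q = \<gamma> \<otimes> p"
  then have "q \<in> proj p"
    by (auto simp: r_coset_def)
  then show "proj p = proj q"
    using repr_independence[OF _ _ \<Gamma>, of q p] by simp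
qed

text \<open>A chart of the quotient may arise from several pairs of a sheet and a chart of the group.
  One of them is fixed, so that a tensor field on the group can be read in the charts of the
  quotient; left invariance makes the result compatible with changes of coordinates.\<close>

definition section_of :: "('g set, 'e) chart \<Rightarrow> 'g set \<times> ('g, 'e) chart"
  where "section_of C = (SOME (U, c). c \<in> A \<and> open U \<and> U \<subseteq> fst c \<and> inj_on proj U \<and>
    C = (proj ` U, snd c \<circ> inv_into U proj))"

definition sheet :: "('g set, 'e) chart \<Rightarrow> 'g set"
  where "sheet C = fst (section_of C)"

definition lift_chart :: "('g set, 'e) chart \<Rightarrow> ('g, 'e) chart"
  where "lift_chart C = snd (section_of C)"

lemma
  assumes "C \<in> quotient"
  shows lift_chart: "lift_chart C \<in> A" and open_sheet: "open (sheet C)"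
    and sheet_subset: "sheet C \<subseteq> fst (lift_chart C)" and inj_on_proj: "inj_on proj (sheet C)"
    and chart_eq: "C = (proj ` sheet C, snd (lift_chart C) \<circ> inv_into (sheet C) proj)"
proof -
  have "\<exists>Uc. case Uc of (U, c) \<Rightarrow> c \<in> A \<and> open U \<and> U \<subseteq> fst c \<and> inj_on proj U \<and>
      C = (proj ` U, snd c \<circ> inv_into U proj)"
    using assms by (auto simp: quotient_atlas_def)
  from someI_ex[OF this] show "lift_chart C \<in> A" "open (sheet C)" "sheet C \<subseteq> fst (lift_chart C)"
    "inj_on proj (sheet C)" "C = (proj ` sheet C, snd (lift_chart C) \<circ> inv_into (sheet C) proj)"
    unfolding section_of_def[symmetric] lift_chart_def sheet_def by (simp_all add: case_prod_beta)
qed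

lemma fst_chart: "C \<in> quotient \<Longrightarrow> fst C = proj ` sheet C"
  using arg_cong[OF chart_eq, of C fst] by simp

lemma chart_proj:
  assumes C: "C \<in> quotient" and p: "p \<in> sheet C"
  shows "snd C (proj p) = snd (lift_chart C) p"
proof -
  have "snd C (proj p) = (snd (lift_chart C) \<circ> inv_into (sheet C) proj) (proj p)"
    by (subst chart_eq[OF C]) simp
  then show ?thesis
    using inv_into_f_f[OF inj_on_proj[OF C] p] by simp
qed

lemma inj_on_lift_chart: "C \<in> quotient \<Longrightarrow> inj_on (snd (lift_chart C)) (sheet C)"
  by (rule inj_on_subset[OF inj_on_chart[OF lift_chart] sheet_subset])

lemma inj_on_quotient_chart:
  assumes C: "C \<in> quotient"
  shows "inj_on (snd C) (fst C)"
proof (rule inj_onI)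
  fix s t assume st: "s \<in> fst C" "t \<in> fst C" "snd C s = snd C t"
  then obtain p q where "p \<in> sheet C" "q \<in> sheet C" "s = proj p" "t = proj q"
    by (auto simp: fst_chart[OF C])
  then show "s = t"
    using st(3) inj_onD[OF inj_on_lift_chart[OF C]] by (auto simp: chart_proj[OF C])
qed

lemma quotient_chart_image:
  assumes C: "C \<in> quotient"
  shows "chart_image C = snd (lift_chart C) ` sheet C"
  unfolding chart_image_def fst_chart[OF C] image_image
  by (rule image_cong) (simp_all add: chart_proj[OF C])

lemma open_quotient_chart_image: "C \<in> quotient \<Longrightarrow> open (chart_image C)"
  unfolding quotient_chart_image by (intro open_image_chart lift_chart open_sheet sheet_subset)

lemma quotient_chart_image_subset:
  assumes C: "C \<in> quotient"
  shows "chart_image C \<subseteq> chart_image (lift_chart C)"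
  by (subst quotient_chart_image[OF C]) (simp add: chart_image_def image_mono sheet_subset[OF C])

lemma inv_into_quotient_chart:
  assumes C: "C \<in> quotient" and p: "p \<in> sheet C"
  shows "inv_into (fst C) (snd C) (snd (lift_chart C) p) = proj p"
  by (rule inv_into_f_eq[OF inj_on_quotient_chart[OF C]]) (simp_all add: fst_chart chart_proj C p)

text \<open>The sheets over a common point differ by an element of \<open>\<Gamma>\<close>, so near that point the change of
  coordinates is a left translation read in charts of the group.\<close>

lemma quotient_transition:
  assumes C: "C \<in> quotient" and D: "D \<in> quotient" and x: "x \<in> local_dom id C D"
  obtains \<gamma> N where "\<gamma> \<in> \<Gamma>" "open N" "x \<in> N" "N \<subseteq> local_dom id C D"
    "N \<subseteq> local_dom (\<lambda>p. \<gamma> \<otimes> p) (lift_chart C) (lift_chart D)"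
    "\<And>y. y \<in> N \<Longrightarrow>
      local_rep id C D y = local_rep (\<lambda>p. \<gamma> \<otimes> p) (lift_chart C) (lift_chart D) y"
proof -
  obtain r where r: "r \<in> proj ` sheet C" "r \<in> proj ` sheet D" "x = snd C r"
    using x by (auto simp: local_dom_def fst_chart[OF C] fst_chart[OF D])
  from r(1,2) obtain p q where "p \<in> sheet C" "q \<in> sheet D" "r = proj p" "r = proj q"
    by blast
  with r(3) have p: "p \<in> sheet C" "q \<in> sheet D" "proj p = proj q" "x = snd (lift_chart C) p"
    by (simp_all add: chart_proj[OF C])
  then obtain \<gamma> where \<gamma>: "\<gamma> \<in> \<Gamma>" "q = \<gamma> \<otimes> p"
    by (auto simp: proj_eq_iff)
  define U where "U = sheet C \<inter> {p. \<gamma> \<otimes> p \<in> sheet D}"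
  have U: "proj r = proj (\<gamma> \<otimes> r)" for r
    using \<gamma>(1) by (auto simp: proj_eq_iff)
  show ?thesis
  proof
    show "\<gamma> \<in> \<Gamma>" by fact
    show "open (snd (lift_chart C) ` U)"
      unfolding U_def using sheet_subset[OF C]
      by (intro open_image_chart open_Int open_translate_vimage lift_chart open_sheet C D) auto
    show "x \<in> snd (lift_chart C) ` U"
      using p \<gamma> by (auto simp: U_def)
    show "snd (lift_chart C) ` U \<subseteq> local_dom id C D"
    proof
      fix y assume "y \<in> snd (lift_chart C) ` U"
      then obtain r where r: "r \<in> sheet C" "\<gamma> \<otimes> r \<in> sheet D" "y = snd (lift_chart C) r"
        by (auto simp: U_def)
      have "proj r \<in> fst C"
        using r by (simp add: fst_chart[OF C])
      moreover have "proj r \<in> fst D"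
        unfolding U[of r] using r by (simp add: fst_chart[OF D])
      ultimately show "y \<in> local_dom id C D"
        using r by (auto simp: local_dom_def chart_proj[OF C, symmetric])
    qed
    show "snd (lift_chart C) ` U \<subseteq> local_dom (\<lambda>p. \<gamma> \<otimes> p) (lift_chart C) (lift_chart D)"
      unfolding local_dom_translation U_def using sheet_subset[OF C] sheet_subset[OF D] by blast
    fix y assume "y \<in> snd (lift_chart C) ` U"
    then obtain r where r: "r \<in> sheet C" "\<gamma> \<otimes> r \<in> sheet D" "y = snd (lift_chart C) r"
      by (auto simp: U_def)
    have "local_rep id C D y = snd D (proj r)"
      using r by (simp add: local_rep_def inv_into_quotient_chart C)
    also have "\<dots> = snd (lift_chart D) (\<gamma> \<otimes> r)"
      using r by (simp add: U[of r] chart_proj D)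
    also have "\<dots> = local_rep (\<lambda>p. \<gamma> \<otimes> p) (lift_chart C) (lift_chart D) y"
      using r sheet_subset[OF C] by (simp add: local_rep_def inv_into_chart lift_chart C subset_iff)
    finally show "local_rep id C D y = local_rep (\<lambda>p. \<gamma> \<otimes> p) (lift_chart C) (lift_chart D) y" .
  qed
qed

lemma open_quotient_overlap:
  assumes "C \<in> quotient" "D \<in> quotient"
  shows "open (local_dom id C D)"
proof (subst open_subopen, intro ballI)
  fix x assume "x \<in> local_dom id C D"
  from quotient_transition[OF assms this] show "\<exists>N. open N \<and> x \<in> N \<and> N \<subseteq> local_dom id C D"
    by metis
qed

lemma smooth_quotient_transition:
  assumes C: "C \<in> quotient" and D: "D \<in> quotient"
  shows "smooth_on (local_dom id C D) (local_rep id C D)"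
proof (rule smooth_on_local)
  fix x assume "x \<in> local_dom id C D"
  then obtain \<gamma> N where N: "open N" "x \<in> N"
    "N \<subseteq> local_dom (\<lambda>p. \<gamma> \<otimes> p) (lift_chart C) (lift_chart D)"
    "\<And>y. y \<in> N \<Longrightarrow>
      local_rep id C D y = local_rep (\<lambda>p. \<gamma> \<otimes> p) (lift_chart C) (lift_chart D) y"
    using quotient_transition[OF C D] by metis
  have "smooth_on N (local_rep (\<lambda>p. \<gamma> \<otimes> p) (lift_chart C) (lift_chart D))"
    by (rule smooth_on_subset[OF smooth_translation[OF lift_chart[OF C] lift_chart[OF D]] N(3)])
  then have "smooth_on N (local_rep id C D)"
    using smooth_on_cong[OF N(1), of "local_rep id C D"
        "local_rep (\<lambda>p. \<gamma> \<otimes> p) (lift_chart C) (lift_chart D)"] N(4) by simp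
  then show "\<exists>N. open N \<and> x \<in> N \<and> smooth_on N (local_rep id C D)"
    using N by blast
qed

lemma left_invariant_descends:
  assumes C: "C \<in> quotient" and D: "D \<in> quotient" and x: "x \<in> local_dom id C D"
    and \<alpha>: "left_invariant_form G A \<alpha>"
  shows "\<alpha> (lift_chart C) x u
    = \<alpha> (lift_chart D) (local_rep id C D x) (tangent_map id C D x u)"
proof -
  obtain \<gamma> N where N: "open N" "x \<in> N"
    "N \<subseteq> local_dom (\<lambda>p. \<gamma> \<otimes> p) (lift_chart C) (lift_chart D)"
    and eq: "\<And>y. y \<in> N \<Longrightarrow>
      local_rep id C D y = local_rep (\<lambda>p. \<gamma> \<otimes> p) (lift_chart C) (lift_chart D) y"
    using quotient_transition[OF C D x] by metis
  have "(local_rep (\<lambda>p. \<gamma> \<otimes> p) (lift_chart C) (lift_chart D) has_derivative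
      tangent_map (\<lambda>p. \<gamma> \<otimes> p) (lift_chart C) (lift_chart D) x) (at x)"
    using smooth_on_has_derivative[OF smooth_translation[OF lift_chart[OF C] lift_chart[OF D]]] N
    by blast
  then have "(local_rep id C D has_derivative
      tangent_map (\<lambda>p. \<gamma> \<otimes> p) (lift_chart C) (lift_chart D) x) (at x)"
    by (rule has_derivative_transform_within_open[OF _ N(1,2)]) (simp add: eq)
  then have "tangent_map id C D x u = tangent_map (\<lambda>p. \<gamma> \<otimes> p) (lift_chart C) (lift_chart D) x u"
    by (rule dderiv_eqI)
  moreover have "is_pullback (\<lambda>p. \<gamma> \<otimes> p) A A \<alpha> \<alpha>"
    using \<alpha> by (simp add: left_invariant_form_def)
  ultimately show ?thesis
    using N(2,3) lift_chart[OF C] lift_chart[OF D] by (auto simp: is_pullback_def eq[OF N(2)])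
qed

text \<open>In a chart of the quotient and the chart of the group below it, the projection is the identity.\<close>

lemma f_related_proj_lift:
  assumes J: "f_related proj A quotient J0 J"
    and C: "C \<in> quotient" and x: "x \<in> chart_image C"
  shows "J C x u = J0 (lift_chart C) x u"
proof -
  let ?c = "lift_chart C"
  have id: "local_rep proj ?c C y = y" if "y \<in> chart_image C" for y
    using that C sheet_subset[OF C]
    by (auto simp: local_rep_def quotient_chart_image chart_proj inv_into_chart lift_chart subset_iff)
  have "(local_rep proj ?c C has_derivative (\<lambda>u. u)) (at x)"
    by (rule has_derivative_transform_within_open[OF has_derivative_ident
          open_quotient_chart_image[OF C] x]) (simp add: id)
  then have tangent: "tangent_map proj ?c C x u = u" for u
    by (rule dderiv_eqI)
  have "x \<in> local_dom proj ?c C"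
    using x C sheet_subset[OF C] by (auto simp: local_dom_def quotient_chart_image fst_chart)
  then have "tangent_map proj ?c C x (J0 ?c x u) = J C (local_rep proj ?c C x) (tangent_map proj ?c C x u)"
    using J C lift_chart[OF C] by (auto simp: f_related_def)
  then show ?thesis
    by (simp add: tangent id[OF x])
qed

text \<open>Discreteness gives a neighbourhood \<open>S\<close> of the unit such that \<open>b \<otimes> inv a \<in> \<Gamma>\<close> for \<open>a\<close>, \<open>b\<close> in \<open>S\<close> only
  if \<open>a = b\<close>. Without a chart, flatness would hold vacuously.\<close>

lemma quotient_chart_exists:
  assumes "discrete \<Gamma>"
  shows "\<exists>C\<in>quotient. chart_image C \<noteq> {}"
proof -
  obtain c where c: "c \<in> A" "\<one> \<in> fst c"
    using chart_cover by blast
  have "\<one> \<in> \<Gamma>"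
    using \<Gamma> by (rule subgroup.one_closed)
  then obtain T where T: "open T" "T \<inter> \<Gamma> = {\<one>}"
    using assms by (meson discreteD isolated_inE)
  have "continuous_on UNIV (\<lambda>p. (\<lambda>(a, b). a \<otimes> b) (snd p, inv (fst p)))"
    by (intro continuous_on_compose2[OF continuous_mult] continuous_on_Pair continuous_on_snd
        continuous_on_compose2[OF continuous_inv] continuous_on_fst continuous_on_id) auto
  then have "open {p. snd p \<otimes> inv (fst p) \<in> T}"
    using open_vimage[OF T(1), of "\<lambda>p. snd p \<otimes> inv (fst p)"] by (simp add: vimage_def)
  moreover have "(\<one>, \<one>) \<in> {p. snd p \<otimes> inv (fst p) \<in> T}"
    using T by auto
  ultimately obtain U V where "open U" "open V" "(\<one>, \<one>) \<in> U \<times> V"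
    and UV_T: "U \<times> V \<subseteq> {p. snd p \<otimes> inv (fst p) \<in> T}"
    by (rule open_prod_elim)
  then have UV: "open U" "open V" "\<one> \<in> U" "\<one> \<in> V"
    by simp_all
  define S where "S = U \<inter> V \<inter> fst c"
  have "inj_on proj S"
  proof (rule inj_onI)
    fix a b assume ab: "a \<in> S" "b \<in> S" "proj a = proj b"
    then obtain \<gamma> where \<gamma>: "\<gamma> \<in> \<Gamma>" "b = \<gamma> \<otimes> a"
      by (auto simp: proj_eq_iff)
    have "b \<otimes> inv a \<in> T"
      using ab UV_T by (auto simp: S_def)
    moreover have "b \<otimes> inv a = \<gamma>"
      using \<gamma> by (simp add: m_assoc)
    ultimately have "\<gamma> = \<one>"
      using T \<gamma> by auto
    then show "a = b" using \<gamma> by simp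
  qed
  moreover have "open S"
    using UV c by (simp add: S_def open_chart_dom open_Int)
  ultimately have "(proj ` S, snd c \<circ> inv_into S proj) \<in> quotient"
    unfolding quotient_atlas_def using c
    by (intro CollectI exI[of _ S] exI[of _ c]) (auto simp: S_def)
  moreover have "\<one> \<in> S"
    using UV c by (simp add: S_def)
  ultimately show ?thesis
    by (intro bexI) (auto simp: chart_image_def)
qed

text \<open>Left translations act transitively, so an invariant form is determined by its value at a point.\<close>

lemma left_invariant_zero:
  assumes \<alpha>: "\<And>a. is_pullback (\<lambda>p. a \<otimes> p) A A \<alpha> \<alpha>"
    and c: "c \<in> A" "x \<in> chart_image c" and zero: "\<And>u. \<alpha> c x u = 0"
    and d: "d \<in> A" "y \<in> chart_image d"
  shows "\<alpha> d y u = 0"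
proof -
  obtain p q where p: "p \<in> fst c" "x = snd c p" and q: "q \<in> fst d" "y = snd d q"
    using c d by (auto simp: chart_image_def)
  define a where "a = p \<otimes> inv q"
  have a: "a \<otimes> q = p"
    by (simp add: a_def m_assoc)
  then have "y \<in> local_dom (\<lambda>p. a \<otimes> p) d c"
    using p q by (auto simp: local_dom_def)
  moreover have "local_rep (\<lambda>p. a \<otimes> p) d c y = x"
    using p q a by (simp add: local_rep_def inv_into_chart d)
  ultimately have "\<alpha> d y u = \<alpha> c x (tangent_map (\<lambda>p. a \<otimes> p) d c y u)"
    using \<alpha>[of a] c d by (auto simp: is_pullback_def)
  then show ?thesis by (simp add: zero)
qed

end

section \<open>Algebra of the connection form\<close>

lemma vector_4:
  "(vector [a, b, c, d] :: ('a::zero)^4) $ 1 = a"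
  "(vector [a, b, c, d] :: ('a::zero)^4) $ 2 = b"
  "(vector [a, b, c, d] :: ('a::zero)^4) $ 3 = c"
  "(vector [a, b, c, d] :: ('a::zero)^4) $ 4 = d"
  unfolding vector_def by simp_all

text \<open>The connection form \<open>\<theta>\<close>, evaluated on a vector with frame components \<open>w\<close>. It is the only one
  that is skew-Hermitian for the Hermitian form \<open>H\<close> of which the metric below is the real part and
  satisfies \<open>d\<omega> = - \<theta> \<and> \<omega>\<close>: the terms of bidegree \<open>(1,1)\<close> in the structure equations give the
  part of \<open>\<theta>\<close> that is conjugate linear in \<open>w\<close>, and skewness gives the rest.\<close>

definition connection_matrix :: "complex ^ 4 \<Rightarrow> complex ^ 4 ^ 4"
  where "connection_matrix w = vector [
    vector [0, \<i> * w $ 2, - w $ 4, - w $ 3],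
    vector [\<i> * cnj (w $ 4), 0, 0, \<i> * w $ 1],
    vector [cnj (w $ 2), - w $ 1 - cnj (w $ 1), 0, 0],
    vector [- cnj (w $ 3), 0, cnj (w $ 1), 0]]"

text \<open>The real part of the Hermitian form \<open>H\<close> for which the fundamental form \<open>\<i> H\<^sub>j\<^sub>k \<omega>\<^sup>j \<and> cnj \<omega>\<^sup>k\<close> is
  \<open>\<i> \<omega>\<^sup>1 \<and> cnj \<omega>\<^sup>1 + \<omega>\<^sup>2 \<and> cnj \<omega>\<^sup>3 - \<omega>\<^sup>3 \<and> cnj \<omega>\<^sup>2 - \<i> \<omega>\<^sup>4 \<and> cnj \<omega>\<^sup>4\<close>. By the structure equations,
  the exterior derivative of \<open>\<omega>\<^sup>2 \<and> cnj \<omega>\<^sup>3 - \<omega>\<^sup>3 \<and> cnj \<omega>\<^sup>2\<close> cancels that of the last term, so this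
  form is closed.\<close>

definition frame_metric :: "complex ^ 4 \<Rightarrow> complex ^ 4 \<Rightarrow> real"
  where "frame_metric z w = Re (z $ 1 * cnj (w $ 1) - z $ 4 * cnj (w $ 4)
    - \<i> * z $ 2 * cnj (w $ 3) + \<i> * z $ 3 * cnj (w $ 2))"

abbreviation frame_derivative :: "complex ^ 4 \<Rightarrow> complex ^ 4 \<Rightarrow> complex ^ 4"
  where "frame_derivative w z \<equiv> connection_matrix w *v z"

lemma frame_derivative_nth:
  "frame_derivative w z $ 1 = \<i> * w $ 2 * z $ 2 - w $ 4 * z $ 3 - w $ 3 * z $ 4"
  "frame_derivative w z $ 2 = \<i> * cnj (w $ 4) * z $ 1 + \<i> * w $ 1 * z $ 4"
  "frame_derivative w z $ 3 = cnj (w $ 2) * z $ 1 - (w $ 1 + cnj (w $ 1)) * z $ 2"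
  "frame_derivative w z $ 4 = - cnj (w $ 3) * z $ 1 + cnj (w $ 1) * z $ 3"
  by (simp_all add: matrix_vector_mult_def connection_matrix_def sum_4 vector_4 algebra_simps)

lemma bilinear_frame_derivative: "bilinear frame_derivative"
  unfolding bilinear_def
  by (intro conjI allI linearI)
    (simp_all add: vec_eq_iff forall_4 frame_derivative_nth scaleR_conv_of_real[where 'a = complex] algebra_simps)

lemma trace_connection_matrix: "trace (connection_matrix w) = 0"
  by (simp add: trace_def connection_matrix_def sum_4 vector_4)

lemma bilinear_frame_metric: "bilinear frame_metric"
  unfolding bilinear_def frame_metric_def
  by (intro conjI allI linearI) (simp_all add: algebra_simps)

lemma frame_metric_skew:
  "frame_metric (frame_derivative w z) z' + frame_metric z (frame_derivative w z') = 0"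
  by (simp add: frame_metric_def frame_derivative_nth algebra_simps)

lemma frame_metric_commute: "frame_metric z w = frame_metric w z"
  by (simp add: frame_metric_def algebra_simps)

lemma frame_metric_i: "frame_metric (\<i> *s z) (\<i> *s w) = frame_metric z w"
  by (simp add: frame_metric_def algebra_simps)

text \<open>The quadratic form is \<open>\<bar>z\<^sub>1\<bar>\<^sup>2 - \<bar>z\<^sub>4\<bar>\<^sup>2 + 2 Im (z\<^sub>2 cnj z\<^sub>3)\<close>, and the last term is positive for \<open>z\<^sub>2 = \<i> z\<^sub>3\<close>
  and negative for \<open>z\<^sub>2 = - \<i> z\<^sub>3\<close>.\<close>

lemma has_signature_frame_metric: "has_signature frame_metric 4 4"
proof -
  let ?p = "\<lambda>(a, b). vector [a, \<i> * b, b, 0] :: complex ^ 4"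
  let ?n = "\<lambda>(a, b). vector [0, - \<i> * b, b, a] :: complex ^ 4"
  have lin: "linear ?p" "linear ?n"
    by (auto intro!: linearI simp: vec_eq_iff forall_4 vector_4 scaleR_conv_of_real[where 'a = complex] algebra_simps)
  have inj: "inj ?p" "inj ?n"
    by (auto intro!: injI simp: vec_eq_iff forall_4 vector_4)
  have "dim (range ?p) = 4" "dim (range ?n) = 4"
    using dim_image_eq[OF lin(1), of UNIV] dim_image_eq[OF lin(2), of UNIV] inj by simp_all
  moreover have sq: "Re a * Re a + Im a * Im a + (Re b * Re b + Im b * Im b) * 2 > 0"
    if "a \<noteq> 0 \<or> b \<noteq> 0" for a b :: complex
    using that sum_squares_gt_zero_iff[of "Re a" "Im a"] sum_squares_gt_zero_iff[of "Re b" "Im b"]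
      sum_squares_ge_zero[of "Re a" "Im a"] sum_squares_ge_zero[of "Re b" "Im b"]
    by (auto simp: complex_eq_iff)
  moreover have "frame_metric z z > 0" if "z \<in> range ?p" "z \<noteq> 0" for z
  proof -
    obtain a b where z: "z = ?p (a, b)" using \<open>z \<in> range ?p\<close> by auto
    then have "a \<noteq> 0 \<or> b \<noteq> 0" using \<open>z \<noteq> 0\<close> by (auto simp: vec_eq_iff forall_4 vector_4)
    then show ?thesis using sq[of a b] by (simp add: z frame_metric_def vector_4 algebra_simps)
  qed
  moreover have "frame_metric z z < 0" if "z \<in> range ?n" "z \<noteq> 0" for z
  proof -
    obtain a b where z: "z = ?n (a, b)" using \<open>z \<in> range ?n\<close> by auto
    then have "a \<noteq> 0 \<or> b \<noteq> 0" using \<open>z \<noteq> 0\<close> by (auto simp: vec_eq_iff forall_4 vector_4)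
    then show ?thesis using sq[of a b] by (simp add: z frame_metric_def vector_4 algebra_simps)
  qed
  ultimately show ?thesis
    unfolding has_signature_def using lin
    by (intro conjI exI[of _ "range ?p"] exI[of _ "range ?n"])
      (auto intro!: linear_subspace_image simp del: split_paired_All)
qed

text \<open>A proper complex subspace is annihilated by a nonzero complex functional: the real functional
  \<open>inner b\<close> vanishing on it has a complex linear refinement.\<close>

lemma bij_of_complex_independent:
  fixes f :: "'e::euclidean_space \<Rightarrow> complex ^ 'm"
  assumes f: "linear f" and dim: "DIM('e) = 2 * CARD('m)"
    and J: "\<And>u. f (J u) = \<i> *s f u"
    and indep: "\<And>a. (\<And>u. (\<Sum>k\<in>UNIV. a k * f u $ k) = 0) \<Longrightarrow> a = (\<lambda>k. 0)"
  shows "bij f"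
proof -
  have "range f = UNIV"
  proof (rule ccontr)
    assume proper: "range f \<noteq> UNIV"
    have span: "span (range f) = range f"
      using linear_subspace_image[OF f subspace_UNIV] by (simp only: span_eq_iff)
    then have "span (range f) \<subset> span UNIV"
      using proper by (simp only: span_UNIV) blast
    from orthogonal_to_subspace_exists_gen[OF this] obtain b
      where b: "b \<noteq> 0" "\<And>y. y \<in> span (range f) \<Longrightarrow> orthogonal b y"
      by blast
    have inner: "b \<bullet> y = Re (\<Sum>k\<in>UNIV. cnj (b $ k) * y $ k)" for y
      by (simp add: inner_vec_def inner_complex_def)
    have "(\<Sum>k\<in>UNIV. cnj (b $ k) * f u $ k) = 0" for u
    proof -
      have "Re (\<Sum>k\<in>UNIV. cnj (b $ k) * f u $ k) = 0"
        using b(2)[of "f u"] by (simp only: span orthogonal_def inner) simp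
      moreover have "Re (\<Sum>k\<in>UNIV. cnj (b $ k) * f (J u) $ k) = 0"
        using b(2)[of "f (J u)"] by (simp only: span orthogonal_def inner) simp
      then have "Re (\<i> * (\<Sum>k\<in>UNIV. cnj (b $ k) * f u $ k)) = 0"
        by (simp add: J sum_distrib_left algebra_simps)
      ultimately show ?thesis
        by (simp add: complex_eq_iff)
    qed
    from indep[OF this] have "b = 0"
      by (simp add: vec_eq_iff fun_eq_iff)
    with b(1) show False by simp
  qed
  moreover from this have "inj f"
    using f dim by (intro linear_surjective_imp_injective) simp_all
  ultimately show ?thesis by (simp add: bij_def)
qed

section \<open>The invariant coframe on the nilmanifold\<close>

definition coframe_of :: "(4 \<Rightarrow> ('g, 'e) one_form) \<Rightarrow> ('g, 'e) chart \<Rightarrow> 'e \<Rightarrow> 'e \<Rightarrow> complex ^ 4"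
  where "coframe_of \<omega> c x u = (\<chi> k. \<omega> k c x u)"

text \<open>If a complex combination of the \<open>\<omega>\<^sup>k\<close> vanishes at one point, it vanishes everywhere by left
  invariance. Then it represents the zero form, whose coefficients are unique.\<close>

lemma bij_coframe_of:
  fixes A :: "('g::topological_space, real ^ 8) chart set"
  assumes lie: "lie_group G A" and \<Gamma>: "subgroup \<Gamma> G"
    and \<omega>: "basis_invariant_1_0_forms G A J0 \<omega>"
    and c: "c \<in> A" "x \<in> chart_image c"
  shows "bij (coframe_of \<omega> c x)"
proof (rule bij_of_complex_independent)
  interpret lie_group_quotient G A \<Gamma>
    using lie \<Gamma> by (simp add: lie_group_quotient_def lie_group_quotient_axioms_def lie_group_def)
  have form: "one_form A (\<omega> k)" "is_pullback (\<lambda>b. a \<otimes>\<^bsub>G\<^esub> b) A A (\<omega> k) (\<omega> k)"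
    "type_1_0 A J0 (\<omega> k)" for k a
    using \<omega> by (simp_all add: basis_invariant_1_0_forms_def left_invariant_form_def)
  have "linear (\<omega> k c x)" for k
    using form(1) c by (simp add: one_form_def)
  then show "linear (coframe_of \<omega> c x)"
    by (auto intro!: linearI simp: coframe_of_def vec_eq_iff linear_add linear_cmul)
  show "coframe_of \<omega> c x (J0 c x u) = \<i> *s coframe_of \<omega> c x u" for u
    using form(3) c by (simp add: coframe_of_def vec_eq_iff type_1_0_def)
  fix a assume a: "\<And>u. (\<Sum>k\<in>UNIV. a k * coframe_of \<omega> c x u $ k) = 0"
  let ?\<alpha> = "\<lambda>c x u. \<Sum>k\<in>UNIV. a k * \<omega> k c x u"
  have "is_pullback (\<lambda>b. a' \<otimes>\<^bsub>G\<^esub> b) A A ?\<alpha> ?\<alpha>" for a'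
    unfolding is_pullback_def
  proof (intro ballI allI sum.cong refl)
    fix c d y u k assume "c \<in> A" "d \<in> A" "y \<in> local_dom (\<lambda>b. a' \<otimes>\<^bsub>G\<^esub> b) c d"
    then show "a k * \<omega> k c y u = a k * \<omega> k d (local_rep (\<lambda>b. a' \<otimes>\<^bsub>G\<^esub> b) c d y)
        (tangent_map (\<lambda>b. a' \<otimes>\<^bsub>G\<^esub> b) c d y u)"
      using form(2)[of a' k] by (simp add: is_pullback_def)
  qed
  moreover have "?\<alpha> c x u = 0" for u
    using a[of u] by (simp add: coframe_of_def)
  ultimately have vanish: "?\<alpha> d y u = 0" if "d \<in> A" "y \<in> chart_image d" for d y u
    using that by (rule left_invariant_zero[where \<alpha> = ?\<alpha>, OF _ c])
  have zero: "left_invariant_form G A (\<lambda>c x u. 0) \<and> type_1_0 A J0 (\<lambda>c x u. 0)"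
    using lie by (auto simp: left_invariant_form_def one_form_def is_pullback_def type_1_0_def
        linear_zero lie_group_def smooth_manifold_def intro!: smooth_on_const)
  define represents_zero where "represents_zero a \<longleftrightarrow>
    (\<forall>c\<in>A. \<forall>x\<in>chart_image c. \<forall>u. 0 = (\<Sum>k\<in>UNIV. a k * \<omega> k c x u))" for a
  have "\<exists>!a. represents_zero a"
    using \<omega> zero unfolding represents_zero_def basis_invariant_1_0_forms_def by blast
  moreover have "represents_zero a" "represents_zero (\<lambda>k. 0)"
    using vanish by (simp_all add: represents_zero_def)
  ultimately show "a = (\<lambda>k. 0)" by blast
qed simp

lemma smooth_on_coframe_of:
  assumes c: "c \<in> A" and open_c: "open (chart_image c)" and \<omega>: "\<And>k. one_form A (\<omega> k)"
  shows "smooth_on (chart_image c) (\<lambda>x. coframe_of \<omega> c x u)"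
  using \<omega> c by (intro smooth_on_vec[OF open_c]) (simp add: coframe_of_def one_form_def)

text \<open>Componentwise, the structure equations express that the connection given by
  \<open>connection_matrix\<close> has no torsion.\<close>

lemma structure_equations_torsion_free:
  fixes A :: "('g, 'e::euclidean_space) chart set"
  assumes eqs: "structure_equations A \<omega>" and c: "c \<in> A" and open_c: "open (chart_image c)"
    and \<omega>: "\<And>k. one_form A (\<omega> k)" and x: "x \<in> chart_image c"
  shows "dderiv (\<lambda>y. coframe_of \<omega> c y v) x u - dderiv (\<lambda>y. coframe_of \<omega> c y u) x v
    = frame_derivative (coframe_of \<omega> c x v) (coframe_of \<omega> c x u)
      - frame_derivative (coframe_of \<omega> c x u) (coframe_of \<omega> c x v)"
proof -
  have "dderiv (\<lambda>y. coframe_of \<omega> c y v) x u $ k = dderiv (\<lambda>y. \<omega> k c y v) x u" for k u v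
  proof -
    have "((\<lambda>y. coframe_of \<omega> c y v $ k) has_derivative
        (\<lambda>u. dderiv (\<lambda>y. coframe_of \<omega> c y v) x u $ k)) (at x)"
      by (rule bounded_linear.has_derivative[OF bounded_linear_vec_nth
            smooth_on_has_derivative[OF smooth_on_coframe_of[OF c open_c \<omega>] x]])
    then have "((\<lambda>y. \<omega> k c y v) has_derivative
        (\<lambda>u. dderiv (\<lambda>y. coframe_of \<omega> c y v) x u $ k)) (at x)"
      by (simp add: coframe_of_def)
    then show ?thesis
      by (rule dderiv_eqI[symmetric])
  qed
  then have "(dderiv (\<lambda>y. coframe_of \<omega> c y v) x u - dderiv (\<lambda>y. coframe_of \<omega> c y u) x v) $ k
      = ext_d (\<omega> k) c x u v" for k
    by (simp add: ext_d_def)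
  moreover have "ext_d (\<omega> 1) c x u v = 0"
    "ext_d (\<omega> 2) c x u v =
       - \<i> * wedge (\<omega> 1) (\<omega> 4) c x u v + \<i> * wedge (\<omega> 1) (conj_form (\<omega> 4)) c x u v"
    "ext_d (\<omega> 3) c x u v =
       wedge (\<omega> 1) (\<omega> 2) c x u v + wedge (\<omega> 1) (conj_form (\<omega> 2)) c x u v
       - wedge (\<omega> 2) (conj_form (\<omega> 1)) c x u v"
    "ext_d (\<omega> 4) c x u v =
       - wedge (\<omega> 1) (conj_form (\<omega> 3)) c x u v + wedge (\<omega> 3) (conj_form (\<omega> 1)) c x u v"
    using eqs c x unfolding structure_equations_def by blast+
  ultimately show ?thesis
    unfolding vec_eq_iff forall_4
    by (simp add: frame_derivative_nth vector_minus_component[of "frame_derivative _ _"]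
        del: vector_minus_component)
      (simp add: coframe_of_def wedge_def conj_form_def algebra_simps)
qed

text \<open>The left-invariant coframe descends: a change of coordinates of the quotient is locally a left
  translation by an element of \<open>\<Gamma>\<close>.\<close>

lemma coframed_quotient:
  fixes A :: "('g::topological_space, real ^ 8) chart set"
  assumes quotient: "lie_group_quotient G A \<Gamma>"
    and \<omega>: "basis_invariant_1_0_forms G A J0 \<omega>"
  shows "coframed_atlas (quotient_atlas G \<Gamma> A)
    (\<lambda>C. coframe_of \<omega> (lie_group_quotient.lift_chart G A \<Gamma> C))"
proof -
  interpret lie_group_quotient G A \<Gamma> by fact
  have left_inv: "left_invariant_form G A (\<omega> k)" for k
    using \<omega> by (simp add: basis_invariant_1_0_forms_def)
  then have form: "one_form A (\<omega> k)" for k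
    by (simp add: left_invariant_form_def)
  have open_c: "open (chart_image c)" if "c \<in> A" for c
    using lie that by (simp add: lie_group_def smooth_manifold_def)
  show ?thesis
  proof (rule coframed_atlas.intro)
    fix C assume C: "C \<in> quotient"
    note c = lift_chart[OF C] and sub = quotient_chart_image_subset[OF C]
    show "inj_on (snd C) (fst C)" "open (chart_image C)"
      by (rule inj_on_quotient_chart[OF C], rule open_quotient_chart_image[OF C])
    show "smooth_on (chart_image C) (\<lambda>x. coframe_of \<omega> (lift_chart C) x u)" for u
      by (rule smooth_on_subset[OF smooth_on_coframe_of[OF c open_c[OF c] form] sub])
    fix x assume "x \<in> chart_image C"
    with sub have x: "x \<in> chart_image (lift_chart C)" by blast
    have "linear (\<omega> k (lift_chart C) x)" for k
      using form c x by (simp add: one_form_def)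
    then show "linear (coframe_of \<omega> (lift_chart C) x)"
      by (auto intro!: linearI simp: coframe_of_def vec_eq_iff linear_add linear_cmul)
    show "bij (coframe_of \<omega> (lift_chart C) x)"
      by (rule bij_coframe_of[OF lie \<Gamma> \<omega> c x])
  next
    fix C D assume CD: "C \<in> quotient" "D \<in> quotient"
    show "open (local_dom id C D)" "smooth_on (local_dom id C D) (local_rep id C D)"
      by (rule open_quotient_overlap[OF CD], rule smooth_quotient_transition[OF CD])
    show "coframe_of \<omega> (lift_chart C) x u
        = coframe_of \<omega> (lift_chart D) (local_rep id C D x) (tangent_map id C D x u)"
      if "x \<in> local_dom id C D" for x u
      unfolding coframe_of_def vec_eq_iff
      by (simp add: left_invariant_descends[OF CD that left_inv, symmetric])
  qed
qed

theorem proposition3p4: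
  fixes G :: "('g::topological_space) monoid"
    and A :: "('g, real ^ 8) chart set"
    and \<Gamma> :: "'g set"
    and J0 :: "('g, real ^ 8) endo_field"
    and J :: "('g set, real ^ 8) endo_field"
    and \<omega> :: "4 \<Rightarrow> ('g, real ^ 8) one_form"
  assumes "nilmanifold G A \<Gamma>"
    and "induced_complex_structure G A \<Gamma> J0 J"
    and "basis_invariant_1_0_forms G A J0 \<omega>"
    and "structure_equations A \<omega>"
  shows "\<exists>(g :: ('g set, real ^ 8) bilinear_field) (D :: ('g set, real ^ 8) conn)
            (\<Phi> :: ('g set, real ^ 8, 4) multi_form).
           neutral_calabi_yau (quotient_atlas G \<Gamma> A) J g D \<Phi> \<and>
           \<not> flat (quotient_atlas G \<Gamma> A) D"
proof -
  have quotient: "lie_group_quotient G A \<Gamma>" and discrete: "discrete \<Gamma>"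
    using assms(1) by (auto simp: nilmanifold_def lattice_subgroup_def lie_group_quotient_def
        lie_group_quotient_axioms_def lie_group_def)
  interpret lie_group_quotient G A \<Gamma> by fact
  define W where "W C = coframe_of \<omega> (lift_chart C)" for C
  have frame: "coframed_atlas quotient W"
    unfolding W_def by (rule coframed_quotient[OF quotient assms(3)])
  interpret coframed_atlas quotient W by fact
  let ?g = "\<lambda>C x u v. frame_metric (W C x u) (W C x v)"
  let ?D = "connection frame_derivative"
  have form: "one_form A (\<omega> k)" "type_1_0 A J0 (\<omega> k)" for k
    using assms(3) by (simp_all add: basis_invariant_1_0_forms_def left_invariant_form_def)
  have open_c: "open (chart_image c)" if "c \<in> A" for c
    using lie that by (simp add: lie_group_def smooth_manifold_def)
  have endo: "endo_field quotient J" and proj_J: "f_related proj A quotient J0 J"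
    using assms(2) by (simp_all add: induced_complex_structure_def complex_structure_def)
  have W_J: "W C x (J C x u) = \<i> *s W C x u" if C: "C \<in> quotient" and x: "x \<in> chart_image C" for C x u
    using form(2) lift_chart[OF C] quotient_chart_image_subset[OF C] x
    by (auto simp: W_def f_related_proj_lift[OF proj_J C x] coframe_of_def vec_eq_iff type_1_0_def)
  have d_W: "dderiv (\<lambda>y. W C y v) x u - dderiv (\<lambda>y. W C y u) x v
      = frame_derivative (W C x v) (W C x u) - frame_derivative (W C x u) (W C x v)"
    if C: "C \<in> quotient" "x \<in> chart_image C" for C x u v
    unfolding W_def using C(2) quotient_chart_image_subset[OF C(1)]
    by (intro structure_equations_torsion_free[OF assms(4)] lift_chart[OF C(1)]
        open_c[OF lift_chart[OF C(1)]] form) blast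
  have "pseudo_riemannian quotient 4 4 ?g"
    unfolding pseudo_riemannian_def
    using bilinear_field_coframe[OF bilinear_frame_metric] frame_metric_commute
      has_signature_pullback[OF linear_coframe bij_coframe has_signature_frame_metric]
    by blast
  moreover have "?g C x (J C x u) (J C x v) = ?g C x u v"
    if "C \<in> quotient" "x \<in> chart_image C" for C x u v
    by (simp add: W_J[OF that] frame_metric_i)
  moreover have "levi_civita quotient ?g ?D"
    by (rule levi_civita_connection[OF bilinear_frame_derivative bilinear_frame_metric
          frame_metric_skew d_W])
  moreover have "parallel_endo quotient ?D J"
  proof (rule parallel_endo_connection[OF _ _ endo W_J])
    show "linear (\<lambda>z. \<i> *s z :: complex ^ 4)"
      by (auto intro!: linearI simp: vec_eq_iff algebra_simps)
    show "frame_derivative w (\<i> *s z) = \<i> *s frame_derivative w z" for w z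
      by (simp add: matrix_vector_mult_def vec_eq_iff sum_distrib_left algebra_simps)
  qed
  ultimately have "neutral_kaehler quotient J ?g ?D"
    unfolding neutral_kaehler_def by (intro conjI exI[of _ 2]) simp_all
  then have "neutral_calabi_yau quotient J ?g ?D (volume_form W)"
    unfolding neutral_calabi_yau_def
    using multi_form_volume_form[OF frame] type_p_0_volume_form[of quotient W J, OF W_J]
      volume_form_nonzero[OF frame] parallel_form_volume_form[OF frame trace_connection_matrix]
    by simp
  moreover have "\<not> flat quotient ?D"
  proof
    assume flat: "flat quotient ?D"
    obtain C x where C: "C \<in> quotient" "x \<in> chart_image C"
      using quotient_chart_exists[OF discrete] by blast
    \<comment> \<open>The entry of the curvature form in row 1 and column 2 is
      \<open>- \<omega>\<^sup>1 \<and> cnj \<omega>\<^sup>4 + \<omega>\<^sup>4 \<and> cnj \<omega>\<^sup>1\<close>, which takes the value \<open>- 2\<close> on the first and the fourth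
      frame vector.\<close>
    let ?e = "\<lambda>k. frame C x (axis k 1)"
    have "curvature ?D C x (?e 1) (?e 4) (?e 2) = 0"
      using flat C by (simp add: flat_def)
    then have "0 = W C x (curvature ?D C x (?e 1) (?e 4) (?e 2)) $ 1"
      by (simp add: linear_0[OF linear_coframe[OF C]])
    also have "\<dots> = - 2"
      by (simp add: coframe_curvature[OF bilinear_frame_derivative C] d_W[OF C] coframe_frame[OF C]
          frame_derivative_nth axis_def)
    finally show False by simp
  qed
  ultimately show ?thesis by blast
qed

end
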